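(* Let $M$ be a $C^\infty$ manifold, let $n\geq 3$, let $h$ be a fixed integer with $h\ge 0$ and $0\leq 2h\leq n-3$, and let $P\in\Gamma\wedge^{n}TM$. Assume that for every $x\in M$ there is an open neighbourhood $U_x$ of $x$ such that $P|_{U_x}$ can be written as $$P=\frac{1}{h!(n-h)!}\sum_{\sigma\in S_{n}}(\mathrm{sign}\,\sigma)\,V_{\sigma_{1}}\wedge\dots\wedge V_{\sigma_{h}}\wedge W_{\sigma_{h+1}}\wedge\dots\wedge W_{\sigma_{n}},$$ where $S_n$ is the group of permutations of $\{1,\dots,n\}$ and $V_i,W_j$ $(i,j=1,\dots,n)$ are $2n$ (pointwise linearly) independent vector fields on $U_x$. Then $P$ is a Poisson $n$-vector of constant rank, equal to $2n$ if $h\neq0$ and to $n$ if $h=0$.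
   Context: Everything is in the $C^\infty$ category. An $n$-vector field is a section of $\wedge^n TM$. Given $P\in\Gamma\wedge^nTM$, put $\{f_1,\dots,f_n\}=P(df_1,\dots,df_n)$ for $f_1,\dots,f_n\in C^\infty(M)$. $P$ is called a Poisson $n$-vector if the generalized Jacobi identity of order $n$ holds: $$\sum_{\sigma\in S_{2n-1}}(\mathrm{sign}\,\sigma)\,\{\{f_{\sigma_{1}},\dots,f_{\sigma_{n}}\},f_{\sigma_{n+1}},\dots,f_{\sigma_{2n-1}}\}=0$$ for all $f_1,\dots,f_{2n-1}\in C^\infty(M)$. The rank of $P$ at $x\in M$ is the dimension of the image of the linear map $\sharp_P:\wedge^{n-1}T_x^*M\to T_xM$, $\sharp_P(\lambda)=i(\lambda)P_x$ (contraction of $P_x$ with $\lambda$). *)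

theory Defs
  imports "HOL-Analysis.Analysis" "HOL-Library.Function_Algebras" "HOL-Combinatorics.Permutations"
begin

instantiation "fun" :: (type, real_vector) real_vector
begin

definition scaleR_fun :: "real \<Rightarrow> ('a \<Rightarrow> 'b) \<Rightarrow> 'a \<Rightarrow> 'b" where
  "scaleR_fun r f = (\<lambda>x. r *\<^sub>R f x)"

instance
  by standard (simp_all add: scaleR_fun_def fun_eq_iff scaleR_add_right scaleR_add_left)

end

text \<open>Meant for open \<open>S\<close> only; on Euclidean spaces this is \<open>C\<^sup>k\<close>.\<close>

primrec Ck_on ::
  "nat \<Rightarrow> 'a::real_normed_vector set \<Rightarrow> ('a \<Rightarrow> 'b::real_normed_vector) \<Rightarrow> bool" where
  "Ck_on 0 S f \<longleftrightarrow> continuous_on S f"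
| "Ck_on (Suc k) S f \<longleftrightarrow>
     (\<forall>x\<in>S. f differentiable (at x)) \<and> (\<forall>v. Ck_on k S (\<lambda>x. frechet_derivative f (at x) v))"

definition smooth_on ::
  "'a::real_normed_vector set \<Rightarrow> ('a \<Rightarrow> 'b::real_normed_vector) \<Rightarrow> bool" where
  "smooth_on S f \<longleftrightarrow> (\<forall>k. Ck_on k S f)"

text \<open>A chart \<open>(U, \<phi>)\<close>; the values of \<open>\<phi>\<close> outside \<open>U\<close> are irrelevant.\<close>

type_synonym ('a, 'e) chart = "'a set \<times> ('a \<Rightarrow> 'e)"

definition chart_inv :: "('a, 'e) chart \<Rightarrow> 'e \<Rightarrow> 'a" where
  "chart_inv c = inv_into (fst c) (snd c)"

definition is_chart :: "'a topology \<Rightarrow> ('a, 'e::euclidean_space) chart \<Rightarrow> bool" where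
  "is_chart X c \<longleftrightarrow>
     openin X (fst c) \<and> open (snd c ` fst c) \<and>
     homeomorphic_map (subtopology X (fst c)) (top_of_set (snd c ` fst c)) (snd c)"

definition transition :: "('a, 'e) chart \<Rightarrow> ('a, 'e) chart \<Rightarrow> 'e \<Rightarrow> 'e" where
  "transition c c' = snd c' \<circ> chart_inv c"

text \<open>The atlas \<open>A\<close> is not required to be maximal. Since \<open>A\<close> covers the space, it also determines
  the set of points, so the notions below depend only on \<open>A\<close>.\<close>

definition smooth_manifold :: "'a topology \<Rightarrow> ('a, 'e::euclidean_space) chart set \<Rightarrow> bool" where
  "smooth_manifold X A \<longleftrightarrow>
     Hausdorff_space X \<and> second_countable X \<and>
     (\<forall>c\<in>A. is_chart X c) \<and> (\<Union>c\<in>A. fst c) = topspace X \<and>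
     (\<forall>c\<in>A. \<forall>c'\<in>A. smooth_on (snd c ` (fst c \<inter> fst c')) (transition c c'))"

definition smooth_function :: "('a, 'e::euclidean_space) chart set \<Rightarrow> ('a \<Rightarrow> real) \<Rightarrow> bool" where
  "smooth_function A f \<longleftrightarrow> (\<forall>c\<in>A. smooth_on (snd c ` fst c) (f \<circ> chart_inv c))"

definition charts_at :: "('a, 'e) chart set \<Rightarrow> 'a \<Rightarrow> ('a, 'e) chart set" where
  "charts_at A x = {c \<in> A. x \<in> fst c}"

definition chart_at :: "('a, 'e) chart set \<Rightarrow> 'a \<Rightarrow> ('a, 'e) chart" where
  "chart_at A x = (SOME c. c \<in> charts_at A x)"

text \<open>A tangent vector at \<open>x\<close> is the family of its coordinate representations in all charts around
  \<open>x\<close>, related by the derivatives of the transition maps; the family is zero at all other indices,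
  so that distinct elements of \<open>tangent_space A x\<close> are distinct tangent vectors.\<close>

type_synonym ('a, 'e) tvec = "('a, 'e) chart \<Rightarrow> 'e"

definition tangent_space :: "('a, 'e::euclidean_space) chart set \<Rightarrow> 'a \<Rightarrow> ('a, 'e) tvec set" where
  "tangent_space A x =
     {v. (\<forall>c. c \<notin> charts_at A x \<longrightarrow> v c = 0) \<and>
         (\<forall>c\<in>charts_at A x. \<forall>c'\<in>charts_at A x.
            v c' = frechet_derivative (transition c c') (at (snd c x)) (v c))}"

type_synonym ('a, 'e) covec = "('a, 'e) tvec \<Rightarrow> real"

definition cotangent_space :: "('a, 'e::euclidean_space) chart set \<Rightarrow> 'a \<Rightarrow> ('a, 'e) covec set" where
  "cotangent_space A x =
     {\<alpha>. (\<forall>v. v \<notin> tangent_space A x \<longrightarrow> \<alpha> v = 0) \<and>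
         (\<forall>u\<in>tangent_space A x. \<forall>v\<in>tangent_space A x. \<alpha> (u + v) = \<alpha> u + \<alpha> v) \<and>
         (\<forall>v\<in>tangent_space A x. \<forall>r. \<alpha> (r *\<^sub>R v) = r * \<alpha> v)}"

text \<open>The differential \<open>df\<close> at \<open>x\<close>, computed in some chart around \<open>x\<close>; by the chain rule the choice is
  irrelevant for smooth \<open>f\<close>.\<close>

definition differential ::
  "('a, 'e::euclidean_space) chart set \<Rightarrow> 'a \<Rightarrow> ('a \<Rightarrow> real) \<Rightarrow> ('a, 'e) covec" where
  "differential A x f =
     (\<lambda>v. if v \<in> tangent_space A x
          then let c = chart_at A x
               in frechet_derivative (f \<circ> chart_inv c) (at (snd c x)) (v c)
          else 0)"

definition coord_vec ::
  "('a, 'e::euclidean_space) chart set \<Rightarrow> ('a, 'e) chart \<Rightarrow> 'a \<Rightarrow> 'e \<Rightarrow> ('a, 'e) tvec" where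
  "coord_vec A c x b =
     (\<lambda>c'. if c' \<in> charts_at A x then frechet_derivative (transition c c') (at (snd c x)) b else 0)"

definition coord_covec ::
  "('a, 'e::euclidean_space) chart set \<Rightarrow> ('a, 'e) chart \<Rightarrow> 'a \<Rightarrow> 'e \<Rightarrow> ('a, 'e) covec" where
  "coord_covec A c x b = (\<lambda>v. if v \<in> tangent_space A x then v c \<bullet> b else 0)"

definition smooth_vector_field_on ::
  "('a, 'e::euclidean_space) chart set \<Rightarrow> 'a set \<Rightarrow> ('a \<Rightarrow> ('a, 'e) tvec) \<Rightarrow> bool" where
  "smooth_vector_field_on A U V \<longleftrightarrow>
     (\<forall>x\<in>U. V x \<in> tangent_space A x) \<and>
     (\<forall>c\<in>A. smooth_on (snd c ` (fst c \<inter> U)) (\<lambda>z. V (chart_inv c z) c))"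

text \<open>\<open>k\<close>-linear maps on \<open>S\<close> are only constrained on the lists in \<open>arg_lists S k\<close>, and two such maps
  are to be compared only there.\<close>

definition arg_lists :: "'v set \<Rightarrow> nat \<Rightarrow> 'v list set" where
  "arg_lists S k = {xs. set xs \<subseteq> S \<and> length xs = k}"

definition alternating_on :: "'v::real_vector set \<Rightarrow> nat \<Rightarrow> ('v list \<Rightarrow> real) \<Rightarrow> bool" where
  "alternating_on S k T \<longleftrightarrow>
     (\<forall>xs\<in>arg_lists S k. \<forall>i<k. \<forall>u\<in>S. \<forall>v\<in>S. T (xs[i := u + v]) = T (xs[i := u]) + T (xs[i := v])) \<and>
     (\<forall>xs\<in>arg_lists S k. \<forall>i<k. \<forall>u\<in>S. \<forall>r. T (xs[i := r *\<^sub>R u]) = r * T (xs[i := u])) \<and>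
     (\<forall>xs\<in>arg_lists S k. \<forall>i<k. \<forall>j<k. i \<noteq> j \<and> xs ! i = xs ! j \<longrightarrow> T xs = 0)"

text \<open>Tangent spaces being finite-dimensional, elements of the \<open>k\<close>-th exterior power of the tangent
  (cotangent) space at \<open>x\<close> are alternating \<open>k\<close>-linear maps on the cotangent (tangent) space.\<close>

type_synonym ('a, 'e) mvec = "('a, 'e) covec list \<Rightarrow> real"

definition multivectors ::
  "('a, 'e::euclidean_space) chart set \<Rightarrow> nat \<Rightarrow> 'a \<Rightarrow> ('a, 'e) mvec set" where
  "multivectors A k x = {Q. alternating_on (cotangent_space A x) k Q}"

definition forms ::
  "('a, 'e::euclidean_space) chart set \<Rightarrow> nat \<Rightarrow> 'a \<Rightarrow> (('a, 'e) tvec list \<Rightarrow> real) set" where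
  "forms A k x = {\<omega>. alternating_on (tangent_space A x) k \<omega>}"

text \<open>Normalised so that \<open>(v\<^sub>0 \<and> \<dots> \<and> v\<^bsub>k-1\<^esub>)(\<alpha>\<^sub>0, \<dots>, \<alpha>\<^bsub>k-1\<^esub>) = det (\<alpha>\<^sub>i(v\<^sub>j))\<close>.\<close>

definition wedge :: "('a, 'e) tvec list \<Rightarrow> ('a, 'e) mvec" where
  "wedge vs \<alpha>s =
     (\<Sum>p | p permutes {..<length vs}.
        of_int (sign p) * (\<Prod>i<length vs. (\<alpha>s ! i) (vs ! p i)))"

definition multivector_field ::
  "('a, 'e::euclidean_space) chart set \<Rightarrow> nat \<Rightarrow> ('a \<Rightarrow> ('a, 'e) mvec) \<Rightarrow> bool" where
  "multivector_field A n P \<longleftrightarrow>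
     (\<forall>x \<in> (\<Union>c\<in>A. fst c). P x \<in> multivectors A n x) \<and>
     (\<forall>c\<in>A. \<forall>bs\<in>arg_lists Basis n.
        smooth_on (snd c ` fst c)
          (\<lambda>z. P (chart_inv c z) (map (coord_covec A c (chart_inv c z)) bs)))"

definition bracket ::
  "('a, 'e::euclidean_space) chart set \<Rightarrow> ('a \<Rightarrow> ('a, 'e) mvec) \<Rightarrow> ('a \<Rightarrow> real) list \<Rightarrow> 'a \<Rightarrow> real" where
  "bracket A P fs = (\<lambda>x. P x (map (differential A x) fs))"

definition poisson_multivector ::
  "('a, 'e::euclidean_space) chart set \<Rightarrow> nat \<Rightarrow> ('a \<Rightarrow> ('a, 'e) mvec) \<Rightarrow> bool" where
  "poisson_multivector A n P \<longleftrightarrow>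
     multivector_field A n P \<and>
     (\<forall>f :: nat \<Rightarrow> 'a \<Rightarrow> real. (\<forall>i\<in>{1..2*n-1}. smooth_function A (f i)) \<longrightarrow>
        (\<forall>x \<in> (\<Union>c\<in>A. fst c).
           (\<Sum>\<sigma> | \<sigma> permutes {1..2*n-1}.
              of_int (sign \<sigma>) *
              bracket A P
                (bracket A P (map (\<lambda>i. f (\<sigma> i)) [1..<n+1]) # map (\<lambda>i. f (\<sigma> i)) [n+1..<2*n]) x) = 0))"

text \<open>The contraction \<open>i(\<omega>)Q\<close> of an \<open>n\<close>-vector \<open>Q\<close> with an \<open>(n-1)\<close>-form \<open>\<omega>\<close>, written out in the
  coordinate frame of a chart: its component with index \<open>b\<close> is
  \<open>1/(n-1)! \<Sum> \<omega>\<^bsub>a1 \<dots> a(n-1)\<^esub> Q\<^bsup>a1 \<dots> a(n-1) b\<^esup>\<close>. It does not depend on the chart, and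
  \<open>i(\<alpha>\<^sub>1 \<and> \<dots> \<and> \<alpha>\<^bsub>n-1\<^esub>)Q = Q(\<alpha>\<^sub>1, \<dots>, \<alpha>\<^bsub>n-1\<^esub>, \<cdot>)\<close>.\<close>

definition contraction ::
  "('a, 'e::euclidean_space) chart set \<Rightarrow> 'a \<Rightarrow> nat \<Rightarrow>
     (('a, 'e) tvec list \<Rightarrow> real) \<Rightarrow> ('a, 'e) mvec \<Rightarrow> ('a, 'e) tvec" where
  "contraction A x n \<omega> Q =
     (let c = chart_at A x in
      \<Sum>b\<in>Basis.
        ((\<Sum>as\<in>arg_lists Basis (n - 1).
            \<omega> (map (coord_vec A c x) as) * Q (map (coord_covec A c x) as @ [coord_covec A c x b]))
          / fact (n - 1)) *\<^sub>R coord_vec A c x b)"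

definition rank_at ::
  "('a, 'e::euclidean_space) chart set \<Rightarrow> nat \<Rightarrow> ('a \<Rightarrow> ('a, 'e) mvec) \<Rightarrow> 'a \<Rightarrow> nat" where
  "rank_at A n P x = dim ((\<lambda>\<omega>. contraction A x n \<omega> (P x)) ` forms A (n - 1) x)"

end

theory Submission
  imports Defs
begin

text \<open>
  Both claims are local. On \<open>U\<close> the multivector \<open>P\<close> is the coefficient of \<open>t\<^sup>h\<close> in
  \<open>(W\<^sub>1 + t V\<^sub>1) \<and> \<dots> \<and> (W\<^sub>n + t V\<^sub>n)\<close>: a signed sum of products of \<open>n\<close> vector fields, one
  from each pair \<open>V\<^sub>i, W\<^sub>i\<close>, in which exactly \<open>h\<close> of the factors are \<open>V\<close>'s.

  \<^emph>\<open>Jacobi identity.\<close> The identity holds because there are too many \<open>W\<close>'s. By the product rule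
  the double bracket is a sum of products of \<open>2n - 1\<close> factors, one for each function. One factor
  contains a second derivative or a derivative of a vector field; each of the other \<open>2n - 2\<close> is
  the derivative of a function along one of the vector fields. At most \<open>2h \<le> n - 3\<close> of these
  fields are \<open>V\<close>'s, so at least \<open>n + 1\<close> are among the \<open>n\<close> fields \<open>W\<^sub>1, \<dots>, W\<^sub>n\<close>, and one of
  them occurs twice (\<open>frame_key_collision\<close>). Alternating over all permutations of the functions
  gives a determinant with two equal rows (\<open>alternating_sum_eq_0\<close>, \<open>jacobi_sum_eq_0\<close>). The
  argument is the same for even and odd \<open>n\<close>, and it never separates the part of the identity that
  is of second order in the functions from the part of first order.

  \<^emph>\<open>Rank.\<close> A contraction of \<open>P\<close> with an \<open>(n-1)\<close>-form is a combination of the fields that can be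
  left over in a term of \<open>P\<close> (\<open>contraction_expansion\<close>). Every \<open>W\<^sub>i\<close> can be left over, and every
  \<open>V\<^sub>i\<close> can if \<open>h > 0\<close>, which gives \<open>n\<close> or \<open>2n\<close> independent vectors. Each of them is indeed
  reached: remove it from a term of \<open>P\<close> and contract with the product of the covectors dual to the
  other \<open>n - 1\<close> fields of this term. A term of \<open>P\<close> that contains these fields contains the removed
  one as well, since its index and its letter are determined by the others, and it enters with the
  same sign (\<open>frame_key_rigid\<close>), so nothing cancels (\<open>frame_in_span_contractions\<close>).
\<close>

section \<open>Charts, tangent vectors and differentials\<close>

lemma smooth_on_differentiable:
  "smooth_on S f \<Longrightarrow> x \<in> S \<Longrightarrow> f differentiable (at x)"
  unfolding smooth_on_def by (metis Ck_on.simps(2))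

lemma smooth_on_derivative_differentiable:
  assumes "smooth_on S f" "x \<in> S"
  shows "(\<lambda>x. frechet_derivative f (at x) v) differentiable (at x)"
proof -
  have "Ck_on (Suc (Suc 0)) S f"
    using assms(1) unfolding smooth_on_def by blast
  then have "Ck_on (Suc 0) S (\<lambda>x. frechet_derivative f (at x) v)"
    unfolding Ck_on.simps(2)[of "Suc 0"] by blast
  then show ?thesis
    using assms(2) unfolding Ck_on.simps(2) by blast
qed

lemma sum_fun_apply: "(\<Sum>i\<in>I. f i) x = (\<Sum>i\<in>I. f i x)"
  for f :: "'i \<Rightarrow> 'b \<Rightarrow> 'c::comm_monoid_add"
  by (induction I rule: infinite_finite_induct) auto

lemma scaleR_fun_apply: "(r *\<^sub>R f) x = r *\<^sub>R f x"
  by (simp add: scaleR_fun_def)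

locale smooth_atlas =
  fixes X :: "'a topology" and A :: "('a, 'e::euclidean_space) chart set"
  assumes manifold: "smooth_manifold X A"
begin

lemma topspace_eq: "topspace X = (\<Union>c\<in>A. fst c)"
  using manifold by (simp add: smooth_manifold_def)

lemma chart_is_chart: "c \<in> A \<Longrightarrow> is_chart X c"
  using manifold by (simp add: smooth_manifold_def)

lemma chart_open: "c \<in> A \<Longrightarrow> openin X (fst c)"
  using chart_is_chart by (simp add: is_chart_def)

lemma chart_inj:
  assumes "c \<in> A"
  shows "inj_on (snd c) (fst c)"
proof -
  have "homeomorphic_map (subtopology X (fst c)) (top_of_set (snd c ` fst c)) (snd c)"
    using chart_is_chart[OF assms] by (simp add: is_chart_def)
  then have "inj_on (snd c) (topspace (subtopology X (fst c)))"
    by (simp add: homeomorphic_eq_everything_map)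
  then show ?thesis
    using openin_subset[OF chart_open[OF assms]] by (simp add: Int_absorb1 inf.commute)
qed

lemma chart_inv_chart [simp]: "c \<in> A \<Longrightarrow> y \<in> fst c \<Longrightarrow> chart_inv c (snd c y) = y"
  by (simp add: chart_inv_def chart_inj)

lemma open_chart_image:
  assumes "c \<in> A" "openin X U"
  shows "open (snd c ` (fst c \<inter> U))"
proof -
  have c: "open (snd c ` fst c)"
    "homeomorphic_map (subtopology X (fst c)) (top_of_set (snd c ` fst c)) (snd c)"
    using chart_is_chart[OF assms(1)] by (simp_all add: is_chart_def)
  have "openin (subtopology X (fst c)) (fst c \<inter> U)"
    using assms(2) by (simp add: openin_subtopology_Int2)
  then have "openin (top_of_set (snd c ` fst c)) (snd c ` (fst c \<inter> U))"
    using homeomorphic_imp_open_map[OF c(2)] by (simp add: open_map_def)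
  then show ?thesis
    using c(1) openin_open_eq by blast
qed

lemma charts_atD: "c \<in> charts_at A x \<Longrightarrow> c \<in> A" "c \<in> charts_at A x \<Longrightarrow> x \<in> fst c"
  by (simp_all add: charts_at_def)

lemma chart_at_in:
  assumes "x \<in> topspace X"
  shows "chart_at A x \<in> charts_at A x"
proof -
  have "\<exists>c. c \<in> charts_at A x"
    using assms by (auto simp: topspace_eq charts_at_def)
  then show ?thesis unfolding chart_at_def by (rule someI_ex)
qed

lemma transition_differentiable:
  assumes "c \<in> charts_at A x" "c' \<in> charts_at A x"
  shows "transition c c' differentiable (at (snd c x))"
proof (rule smooth_on_differentiable)
  show "smooth_on (snd c ` (fst c \<inter> fst c')) (transition c c')"
    using manifold assms by (simp add: smooth_manifold_def charts_at_def)
  show "snd c x \<in> snd c ` (fst c \<inter> fst c')"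
    using assms by (simp add: charts_at_def)
qed

lemma transition_linear:
  "c \<in> charts_at A x \<Longrightarrow> c' \<in> charts_at A x \<Longrightarrow>
    linear (frechet_derivative (transition c c') (at (snd c x)))"
  by (rule linear_frechet_derivative[OF transition_differentiable])

lemma tangent_spaceD:
  "v \<in> tangent_space A x \<Longrightarrow> c \<in> charts_at A x \<Longrightarrow> c' \<in> charts_at A x \<Longrightarrow>
    v c' = frechet_derivative (transition c c') (at (snd c x)) (v c)"
  "v \<in> tangent_space A x \<Longrightarrow> c \<notin> charts_at A x \<Longrightarrow> v c = 0"
  unfolding tangent_space_def by blast+

lemma tangent_space_add:
  assumes "u \<in> tangent_space A x" "v \<in> tangent_space A x"
  shows "u + v \<in> tangent_space A x"
  unfolding tangent_space_def
proof (intro CollectI conjI allI impI ballI)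
  show "(u + v) c = 0" if "c \<notin> charts_at A x" for c
    using assms that by (simp add: tangent_spaceD(2))
  show "(u + v) c' = frechet_derivative (transition c c') (at (snd c x)) ((u + v) c)"
    if "c \<in> charts_at A x" "c' \<in> charts_at A x" for c c'
    unfolding plus_fun_apply linear_add[OF transition_linear[OF that]]
      tangent_spaceD(1)[OF assms(1) that] tangent_spaceD(1)[OF assms(2) that] ..
qed

lemma tangent_space_scaleR:
  assumes "v \<in> tangent_space A x"
  shows "r *\<^sub>R v \<in> tangent_space A x"
  unfolding tangent_space_def
proof (intro CollectI conjI allI impI ballI)
  show "(r *\<^sub>R v) c = 0" if "c \<notin> charts_at A x" for c
    using assms that by (simp add: tangent_spaceD(2) scaleR_fun_apply)
  show "(r *\<^sub>R v) c' = frechet_derivative (transition c c') (at (snd c x)) ((r *\<^sub>R v) c)"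
    if "c \<in> charts_at A x" "c' \<in> charts_at A x" for c c'
    unfolding scaleR_fun_apply linear_scale[OF transition_linear[OF that]]
      tangent_spaceD(1)[OF assms that] ..
qed

text \<open>Differentials and coordinate covectors both read off one coordinate representation of the
  vector and apply a linear map to it.\<close>

lemma linear_coordinate_in_cotangent_space:
  assumes "linear L"
  shows "(\<lambda>v. if v \<in> tangent_space A x then L (v c) else 0) \<in> cotangent_space A x"
  using linear_add[OF assms] linear_scale[OF assms]
  by (simp add: cotangent_space_def tangent_space_add tangent_space_scaleR scaleR_fun_apply)

lemma coord_covec_in_cotangent_space: "coord_covec A c x b \<in> cotangent_space A x"
  unfolding coord_covec_def
  by (rule linear_coordinate_in_cotangent_space) (rule bounded_linear.linear[OF bounded_linear_inner_left])

lemma differential_in_cotangent_space: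
  assumes "f \<circ> chart_inv (chart_at A x) differentiable (at (snd (chart_at A x) x))"
  shows "differential A x f \<in> cotangent_space A x"
  unfolding differential_def Let_def
  by (rule linear_coordinate_in_cotangent_space[OF linear_frechet_derivative[OF assms]])

text \<open>A tangent vector is determined by its coordinates in one chart, because its other
  coordinates are images of these under the linear derivatives of the transition maps.\<close>

lemma tangent_vector_expansion:
  assumes "v \<in> tangent_space A x" "c \<in> charts_at A x"
  shows "(\<Sum>b\<in>Basis. (v c \<bullet> b) *\<^sub>R coord_vec A c x b) = v"
proof
  fix c'
  have *: "(\<Sum>b\<in>Basis. (v c \<bullet> b) *\<^sub>R coord_vec A c x b) c' =
      (\<Sum>b\<in>Basis. (v c \<bullet> b) *\<^sub>R coord_vec A c x b c')"
    unfolding sum_fun_apply scaleR_fun_apply ..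
  show "(\<Sum>b\<in>Basis. (v c \<bullet> b) *\<^sub>R coord_vec A c x b) c' = v c'"
  proof (cases "c' \<in> charts_at A x")
    case True
    define D where "D = frechet_derivative (transition c c') (at (snd c x))"
    have D: "linear D"
      unfolding D_def by (rule transition_linear[OF assms(2) True])
    have "v c' = D (v c)"
      unfolding D_def by (rule tangent_spaceD(1)[OF assms True])
    also have "\<dots> = D (\<Sum>b\<in>Basis. (v c \<bullet> b) *\<^sub>R b)"
      by (simp only: euclidean_representation)
    also have "\<dots> = (\<Sum>b\<in>Basis. (v c \<bullet> b) *\<^sub>R D b)"
      by (simp only: linear_sum[OF D] linear_scale[OF D])
    finally show ?thesis
      using True unfolding * by (simp add: coord_vec_def D_def)
  next
    case False
    then show ?thesis
      unfolding * tangent_spaceD(2)[OF assms(1) False] by (simp add: coord_vec_def)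
  qed
qed

lemma smooth_function_differentiable:
  "smooth_function A f \<Longrightarrow> c \<in> charts_at A x \<Longrightarrow> f \<circ> chart_inv c differentiable (at (snd c x))"
  by (rule smooth_on_differentiable[of "snd c ` fst c"]) (auto simp: smooth_function_def charts_at_def)

text \<open>Evaluating a differential in a fixed chart, instead of in the chart that
  \<^const>\<open>chart_at\<close> picks at each point separately, is what allows to differentiate brackets
  of functions once more.\<close>

lemma differential_in_chart:
  assumes f: "smooth_function A f" and v: "v \<in> tangent_space A x"
    and c: "c \<in> charts_at A x"
  shows "differential A x f v = frechet_derivative (f \<circ> chart_inv c) (at (snd c x)) (v c)"
proof -
  define d where "d = chart_at A x"
  have x: "x \<in> topspace X"
    using c by (auto simp: topspace_eq charts_at_def)
  have d: "d \<in> charts_at A x"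
    using chart_at_in[OF x] by (simp add: d_def)
  note cd = charts_atD[OF c] charts_atD[OF d]
  have tr: "transition c d (snd c x) = snd d x"
    using cd by (simp add: transition_def)
  have diff: "f \<circ> chart_inv d differentiable (at (transition c d (snd c x)))"
    using smooth_function_differentiable[OF f d] by (simp add: tr)
  have "frechet_derivative (f \<circ> chart_inv c) (at (snd c x)) =
      frechet_derivative ((f \<circ> chart_inv d) \<circ> transition c d) (at (snd c x))"
  proof (rule frechet_derivative_transform_within_open)
    show "f \<circ> chart_inv c differentiable (at (snd c x))"
      by (rule smooth_function_differentiable[OF f c])
    show "open (snd c ` (fst c \<inter> fst d))"
      using cd by (intro open_chart_image chart_open)
    show "snd c x \<in> snd c ` (fst c \<inter> fst d)"
      using cd by simp
    fix z assume "z \<in> snd c ` (fst c \<inter> fst d)"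
    then show "(f \<circ> chart_inv c) z = ((f \<circ> chart_inv d) \<circ> transition c d) z"
      using cd by (auto simp: transition_def)
  qed
  also have "\<dots> = frechet_derivative (f \<circ> chart_inv d) (at (snd d x)) \<circ>
      frechet_derivative (transition c d) (at (snd c x))"
    unfolding frechet_derivative_compose[OF transition_differentiable[OF c d] diff] tr ..
  finally have "frechet_derivative (f \<circ> chart_inv c) (at (snd c x)) (v c) =
      frechet_derivative (f \<circ> chart_inv d) (at (snd d x)) (v d)"
    using tangent_spaceD(1)[OF v c d] by simp
  then show ?thesis
    using v by (simp add: differential_def Let_def d_def)
qed

text \<open>The derivative of \<open>f\<close> along a vector field uses one derivative of \<open>f\<close>; the result is again
  differentiable since \<open>f\<close> has a second one.\<close>

lemma directional_derivative_differentiable: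
  assumes f: "smooth_function A f" and V: "smooth_vector_field_on A U V" and U: "openin X U"
    and c: "c \<in> A" and x: "x \<in> fst c \<inter> U"
  shows "(\<lambda>z. differential A (chart_inv c z) f (V (chart_inv c z))) differentiable (at (snd c x))"
proof -
  define F where "F = f \<circ> chart_inv c"
  have sF: "smooth_on (snd c ` fst c) F"
    using f c by (simp add: smooth_function_def F_def)
  have sV: "smooth_on (snd c ` (fst c \<inter> U)) (\<lambda>z. V (chart_inv c z) c)"
    using V c by (simp add: smooth_vector_field_on_def)
  let ?g = "\<lambda>z. \<Sum>b\<in>Basis. (V (chart_inv c z) c \<bullet> b) * frechet_derivative F (at z) b"
  have g: "differential A (chart_inv c z) f (V (chart_inv c z)) = ?g z"
    if z: "z \<in> snd c ` (fst c \<inter> U)" for z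
  proof -
    obtain y where y: "y \<in> fst c" "y \<in> U" "z = snd c y"
      using z by auto
    have yc: "c \<in> charts_at A y"
      using y c by (simp add: charts_at_def)
    have lin: "linear (frechet_derivative F (at z))"
      unfolding F_def y(3)
      by (rule linear_frechet_derivative[OF smooth_function_differentiable[OF f yc]])
    have "V y \<in> tangent_space A y"
      using V y by (simp add: smooth_vector_field_on_def)
    then have "differential A y f (V y) = frechet_derivative F (at z) (V y c)"
      using differential_in_chart[OF f _ yc] by (simp add: F_def y(3))
    also have "\<dots> = frechet_derivative F (at z) (\<Sum>b\<in>Basis. (V y c \<bullet> b) *\<^sub>R b)"
      by (simp add: euclidean_representation)
    also have "\<dots> = (\<Sum>b\<in>Basis. (V y c \<bullet> b) * frechet_derivative F (at z) b)"
      by (simp add: linear_sum[OF lin] linear_scale[OF lin])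
    finally show ?thesis
      using y c by simp
  qed
  have "?g differentiable (at (snd c x))"
  proof (intro differentiable_sum differentiable_mult differentiable_inner differentiable_const
      finite_Basis ballI)
    show "(\<lambda>z. V (chart_inv c z) c) differentiable (at (snd c x))"
      by (rule smooth_on_differentiable[OF sV]) (use x in auto)
    show "(\<lambda>z. frechet_derivative F (at z) b) differentiable (at (snd c x))" for b
      by (rule smooth_on_derivative_differentiable[OF sF]) (use x in auto)
  qed
  then obtain D where "(?g has_derivative D) (at (snd c x))"
    by (auto simp: differentiable_def)
  then have "((\<lambda>z. differential A (chart_inv c z) f (V (chart_inv c z))) has_derivative D)
      (at (snd c x))"
    by (rule has_derivative_transform_within_open[OF _ open_chart_image[OF c U]])
      (use x g in auto)
  then show ?thesis
    by (auto simp: differentiable_def)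
qed

end

section \<open>The generalized Jacobi identity\<close>

text \<open>This is the determinant of a matrix with two equal rows.\<close>

lemma alternating_sum_eq_0:
  fixes \<phi> :: "'b \<Rightarrow> 'b \<Rightarrow> real"
  assumes S: "finite S" and a: "a \<in> S" and b: "b \<in> S" and ab: "a \<noteq> b" and \<phi>: "\<phi> a = \<phi> b"
  shows "(\<Sum>\<sigma> | \<sigma> permutes S. of_int (sign \<sigma>) * (\<Prod>m\<in>S. \<phi> m (\<sigma> m))) = 0"
proof -
  define t where "t = Transposition.transpose a b"
  have t: "t permutes S"
    unfolding t_def by (rule permutes_swap_id[OF a b])
  have tperm: "permutation t"
    using permutes_imp_permutation[OF S t] .
  let ?g = "\<lambda>\<sigma>. real_of_int (sign \<sigma>) * (\<Prod>m\<in>S. \<phi> m (\<sigma> m))"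
  have "?g (\<sigma> \<circ> t) = - ?g \<sigma>" if \<sigma>: "\<sigma> permutes S" for \<sigma>
  proof -
    have "sign (\<sigma> \<circ> t) = - sign \<sigma>"
      using ab sign_compose[OF permutes_imp_permutation[OF S \<sigma>] tperm]
      by (simp add: t_def sign_swap_id)
    moreover have "(\<Prod>m\<in>S. \<phi> m ((\<sigma> \<circ> t) m)) = (\<Prod>m\<in>S. \<phi> (t m) (\<sigma> (t m)))"
      by (rule prod.cong) (auto simp: t_def Transposition.transpose_def \<phi>)
    moreover have "(\<Prod>m\<in>S. \<phi> (t m) (\<sigma> (t m))) = (\<Prod>m\<in>S. \<phi> m (\<sigma> m))"
      using prod.permute[OF t, of "\<lambda>m. \<phi> m (\<sigma> m)"] by (simp add: comp_def)
    ultimately show ?thesis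
      by simp
  qed
  then have "sum ?g {\<sigma>. \<sigma> permutes S} = - sum ?g {\<sigma>. \<sigma> permutes S}"
    by (subst sum_permutations_compose_right[OF t]) (simp add: sum_negf)
  then show ?thesis
    by simp
qed

text \<open>The Jacobi identity and the contractions depend only on the fact that \<open>P\<close> is locally a finite
  sum of tensor products of smooth vector fields. The factor at position \<open>k\<close> of the term \<open>\<iota>\<close> is
  given by a key rather than directly, because equality of two factors is decided on the keys.\<close>

locale local_frame_expansion = smooth_atlas X A
  for X :: "'a topology" and A :: "('a, 'e::euclidean_space) chart set" +
  fixes U :: "'a set" and n :: nat and P :: "'a \<Rightarrow> ('a, 'e) mvec"
    and I :: "'i set" and coef :: "'i \<Rightarrow> real" and key :: "'i \<Rightarrow> nat \<Rightarrow> 'k"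
    and E :: "'k \<Rightarrow> 'a \<Rightarrow> ('a, 'e) tvec"
  assumes open_U: "openin X U"
    and finite_I: "finite I"
    and smooth_E: "\<iota> \<in> I \<Longrightarrow> k < n \<Longrightarrow> smooth_vector_field_on A U (E (key \<iota> k))"
    and expansion: "y \<in> U \<Longrightarrow> \<alpha>s \<in> arg_lists (cotangent_space A y) n \<Longrightarrow>
      P y \<alpha>s = (\<Sum>\<iota>\<in>I. coef \<iota> * (\<Prod>k<n. (\<alpha>s ! k) (E (key \<iota> k) y)))"
begin

lemma U_topspace: "y \<in> U \<Longrightarrow> y \<in> topspace X"
  using openin_subset[OF open_U] by blast

lemma E_tangent: "\<iota> \<in> I \<Longrightarrow> k < n \<Longrightarrow> y \<in> U \<Longrightarrow> E (key \<iota> k) y \<in> tangent_space A y"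
  using smooth_E by (simp add: smooth_vector_field_on_def)

lemma smooth_differential_in_cotangent_space:
  assumes "smooth_function A f" "y \<in> U"
  shows "differential A y f \<in> cotangent_space A y"
  by (rule differential_in_cotangent_space)
    (rule smooth_function_differentiable[OF assms(1) chart_at_in[OF U_topspace[OF assms(2)]]])

lemma bracket_expansion:
  assumes y: "y \<in> U" and fs: "length fs = n" "\<And>k. k < n \<Longrightarrow> smooth_function A (fs ! k)"
  shows "bracket A P fs y =
    (\<Sum>\<iota>\<in>I. coef \<iota> * (\<Prod>k<n. differential A y (fs ! k) (E (key \<iota> k) y)))"
proof -
  have "map (differential A y) fs \<in> arg_lists (cotangent_space A y) n"
    using fs smooth_differential_in_cotangent_space[OF _ y]
    by (auto simp: arg_lists_def in_set_conv_nth)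
  from expansion[OF y this] show ?thesis
    unfolding bracket_def using fs(1) by simp
qed

text \<open>The inner derivative is along a frame field, whereas the outer one is taken in a single chart,
  so that its direction is a coordinate vector. This is the factor that the product rule singles
  out.\<close>

definition second_derivative :: "'a \<Rightarrow> ('a \<Rightarrow> real) \<Rightarrow> 'k \<Rightarrow> 'e \<Rightarrow> real" where
  "second_derivative x g \<kappa> =
     frechet_derivative
       (\<lambda>z. let y = chart_inv (chart_at A x) z in differential A y g (E \<kappa> y))
       (at (snd (chart_at A x) x))"

lemma bracket_has_derivative:
  assumes x: "x \<in> U" and fs: "length fs = n" "\<And>k. k < n \<Longrightarrow> smooth_function A (fs ! k)"
  defines "c \<equiv> chart_at A x"
  shows "(bracket A P fs \<circ> chart_inv c has_derivative
    (\<lambda>u. \<Sum>\<iota>\<in>I. coef \<iota> * (\<Sum>k<n. second_derivative x (fs ! k) (key \<iota> k) u *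
        (\<Prod>j\<in>{..<n} - {k}. differential A x (fs ! j) (E (key \<iota> j) x))))) (at (snd c x))"
proof -
  have "c \<in> charts_at A x"
    unfolding c_def by (rule chart_at_in[OF U_topspace[OF x]])
  note c = charts_atD[OF this]
  define g where "g f \<kappa> z = differential A (chart_inv c z) f (E \<kappa> (chart_inv c z))" for f \<kappa> z
  have sd: "second_derivative x f \<kappa> = frechet_derivative (g f \<kappa>) (at (snd c x))" for f \<kappa>
    by (simp add: second_derivative_def g_def[abs_def] c_def Let_def)
  have g: "(g (fs ! k) (key \<iota> k) has_derivative second_derivative x (fs ! k) (key \<iota> k))
      (at (snd c x))" if "\<iota> \<in> I" "k < n" for \<iota> k
    unfolding sd g_def frechet_derivative_works[symmetric]
    by (rule directional_derivative_differentiable[OF fs(2)[OF that(2)] smooth_E[OF that] open_U])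
      (use c x in auto)
  have gx: "g f \<kappa> (snd c x) = differential A x f (E \<kappa> x)" for f \<kappa>
    using c by (simp add: g_def)
  have "((\<lambda>z. \<Sum>\<iota>\<in>I. coef \<iota> * (\<Prod>k<n. g (fs ! k) (key \<iota> k) z)) has_derivative
      (\<lambda>u. \<Sum>\<iota>\<in>I. coef \<iota> * (\<Sum>k<n. second_derivative x (fs ! k) (key \<iota> k) u *
        (\<Prod>j\<in>{..<n} - {k}. g (fs ! j) (key \<iota> j) (snd c x))))) (at (snd c x))"
    by (intro has_derivative_sum has_derivative_mult_right has_derivative_prod g) auto
  then show ?thesis
    unfolding gx
  proof (rule has_derivative_transform_within_open)
    show "open (snd c ` (fst c \<inter> U))"
      by (rule open_chart_image[OF c(1) open_U])
    show "snd c x \<in> snd c ` (fst c \<inter> U)"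
      using c x by auto
    fix z assume "z \<in> snd c ` (fst c \<inter> U)"
    then have "chart_inv c z \<in> U"
      using c by auto
    from bracket_expansion[OF this fs]
    show "(\<Sum>\<iota>\<in>I. coef \<iota> * (\<Prod>k<n. g (fs ! k) (key \<iota> k) z)) =
        (bracket A P fs \<circ> chart_inv c) z"
      by (simp add: g_def)
  qed
qed

text \<open>Number the factors of a product in the expanded double bracket by \<open>1, \<dots>, 2n - 1\<close>: the first
  \<open>n\<close> come from a term \<open>\<iota>'\<close> of the inner bracket, the others from the positions \<open>1, \<dots>, n - 1\<close> of a
  term \<open>\<iota>\<close> of the outer bracket, whose position \<open>0\<close> is used up by the direction in which the inner
  bracket is differentiated. The product rule differentiates the factor \<open>k + 1\<close>; if two of the
  remaining ones use the same frame field, the alternating sum is a determinant with two equal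
  rows.\<close>

lemma jacobi_sum_eq_0:
  assumes x: "x \<in> U" and n: "n > 0"
    and f: "\<And>i. i \<in> {1..2*n-1} \<Longrightarrow> smooth_function A (f i)"
    and collision: "\<And>\<iota> \<iota>' k. \<iota> \<in> I \<Longrightarrow> \<iota>' \<in> I \<Longrightarrow> k < n \<Longrightarrow>
      \<not> inj_on (\<lambda>m. if m \<le> n then key \<iota>' (m - 1) else key \<iota> (m - n)) ({1..2*n-1} - {k + 1})"
  shows "(\<Sum>\<sigma> | \<sigma> permutes {1..2*n-1}. of_int (sign \<sigma>) *
      bracket A P
        (bracket A P (map (\<lambda>i. f (\<sigma> i)) [1..<n+1]) # map (\<lambda>i. f (\<sigma> i)) [n+1..<2*n]) x) = 0"
proof -
  define c where "c = chart_at A x"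
  let ?S = "{1..2*n-1}"
  define K where "K \<iota> \<iota>' m = (if m \<le> n then key \<iota>' (m - 1) else key \<iota> (m - n))" for \<iota> \<iota>' m
  \<comment> \<open>\<open>\<phi> \<iota> \<iota>' k m j\<close> is the value of the factor at position \<open>m\<close> when it is occupied by \<open>f j\<close>; as a
    function of \<open>j\<close> it depends on \<open>m \<noteq> k + 1\<close> only through the frame field at \<open>m\<close>.\<close>
  define \<phi> where "\<phi> \<iota> \<iota>' k m j =
      (if m = k + 1 then second_derivative x (f j) (key \<iota>' k) (E (key \<iota> 0) x c)
       else differential A x (f j) (E (K \<iota> \<iota>' m) x))" for \<iota> \<iota>' k m j
  have double_bracket: "bracket A P
        (bracket A P (map (\<lambda>i. f (\<sigma> i)) [1..<n+1]) # map (\<lambda>i. f (\<sigma> i)) [n+1..<2*n]) x =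
      (\<Sum>\<iota>\<in>I. \<Sum>\<iota>'\<in>I. \<Sum>k<n. coef \<iota> * coef \<iota>' * (\<Prod>m\<in>?S. \<phi> \<iota> \<iota>' k m (\<sigma> m)))"
    if \<sigma>: "\<sigma> permutes ?S" for \<sigma>
  proof -
    have f\<sigma>: "smooth_function A (f (\<sigma> i))" if "i \<in> ?S" for i
      using f permutes_in_image[OF \<sigma>] that by blast
    define fs where "fs = map (\<lambda>i. f (\<sigma> i)) [1..<n+1]"
    define gs where "gs = map (\<lambda>i. f (\<sigma> i)) [n+1..<2*n]"
    define G where "G = bracket A P fs"
    have fs: "length fs = n" "\<And>k. k < n \<Longrightarrow> fs ! k = f (\<sigma> (k + 1))"
      by (simp_all add: fs_def del: upt_Suc)
    have fs': "smooth_function A (fs ! k)" if "k < n" for k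
      using that by (simp add: fs(2) f\<sigma>)
    have gs: "length (G # gs) = n" "\<And>k. k \<in> {1..<n} \<Longrightarrow> (G # gs) ! k = f (\<sigma> (n + k))"
      using n by (auto simp: gs_def nth_Cons split: nat.split)
    define DG where "DG u = (\<Sum>\<iota>\<in>I. coef \<iota> * (\<Sum>k<n. second_derivative x (fs ! k) (key \<iota> k) u *
        (\<Prod>j\<in>{..<n} - {k}. differential A x (fs ! j) (E (key \<iota> j) x))))" for u
    have DG: "(G \<circ> chart_inv c has_derivative DG) (at (snd c x))"
      unfolding G_def c_def DG_def by (rule bracket_has_derivative[OF x fs(1) fs'])
    have dG: "differential A x G v = DG (v c)" if "v \<in> tangent_space A x" for v
      using that frechet_derivative_at[OF DG] by (simp add: differential_def Let_def c_def)
    have cot: "differential A x ((G # gs) ! k) \<in> cotangent_space A x" if k: "k < n" for k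
    proof (cases k)
      case 0
      have "G \<circ> chart_inv (chart_at A x) differentiable (at (snd (chart_at A x) x))"
        using DG unfolding c_def differentiable_def by blast
      then show ?thesis
        using 0 by (simp add: differential_in_cotangent_space)
    next
      case (Suc i)
      then have "k \<in> {1..<n}" "n + k \<in> ?S"
        using k by simp_all
      then show ?thesis
        using smooth_differential_in_cotangent_space[OF f\<sigma>[of "n + k"] x] gs(2)[of k] by simp
    qed
    have args: "map (differential A x) (G # gs) \<in> arg_lists (cotangent_space A x) n"
      unfolding arg_lists_def
    proof (intro CollectI conjI subsetI)
      fix \<alpha> assume "\<alpha> \<in> set (map (differential A x) (G # gs))"
      then obtain k where "k < n" "\<alpha> = differential A x ((G # gs) ! k)"
        using gs(1) unfolding set_map by (metis imageE in_set_conv_nth)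
      then show "\<alpha> \<in> cotangent_space A x"
        using cot by simp
    qed (use gs(1) in simp)
    have prod: "second_derivative x (fs ! k) (key \<iota>' k) (E (key \<iota> 0) x c) *
          (\<Prod>j\<in>{..<n} - {k}. differential A x (fs ! j) (E (key \<iota>' j) x)) *
          (\<Prod>j\<in>{1..<n}. differential A x ((G # gs) ! j) (E (key \<iota> j) x)) =
        (\<Prod>m\<in>?S. \<phi> \<iota> \<iota>' k m (\<sigma> m))" if k: "k < n" for \<iota> \<iota>' k
    proof -
      let ?J = "{..<n} - {k}"
      have S: "?S = insert (k + 1) (Suc ` ?J \<union> (+) n ` {1..<n})"
      proof (intro equalityI subsetI)
        fix m assume m: "m \<in> ?S"
        show "m \<in> insert (k + 1) (Suc ` ?J \<union> (+) n ` {1..<n})"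
        proof (cases "m \<le> n")
          case True
          then have "m = Suc (m - 1)" "m - 1 < n" using m by auto
          then show ?thesis by (metis Diff_iff UnI1 Suc_eq_plus1 imageI insertCI insertE lessThan_iff singletonD)
        next
          case False
          then have "m = n + (m - n)" "m - n \<in> {1..<n}" using m by auto
          then show ?thesis by blast
        qed
      qed (use k in auto)
      have "(\<Prod>m\<in>?S. \<phi> \<iota> \<iota>' k m (\<sigma> m)) = \<phi> \<iota> \<iota>' k (k + 1) (\<sigma> (k + 1)) *
          ((\<Prod>m\<in>Suc ` ?J. \<phi> \<iota> \<iota>' k m (\<sigma> m)) * (\<Prod>m\<in>(+) n ` {1..<n}. \<phi> \<iota> \<iota>' k m (\<sigma> m)))"
      proof -
        have "k + 1 \<notin> Suc ` ?J \<union> (+) n ` {1..<n}" "Suc ` ?J \<inter> (+) n ` {1..<n} = {}"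
          using k by auto
        then show ?thesis
          unfolding S by (simp add: prod.union_disjoint)
      qed
      moreover have "\<phi> \<iota> \<iota>' k (k + 1) (\<sigma> (k + 1)) =
          second_derivative x (fs ! k) (key \<iota>' k) (E (key \<iota> 0) x c)"
        using k by (simp add: \<phi>_def fs(2))
      moreover have "(\<Prod>m\<in>Suc ` ?J. \<phi> \<iota> \<iota>' k m (\<sigma> m)) =
          (\<Prod>j\<in>?J. differential A x (fs ! j) (E (key \<iota>' j) x))"
        by (subst prod.reindex) (auto simp: \<phi>_def K_def fs(2) intro!: prod.cong)
      moreover have "(\<Prod>m\<in>(+) n ` {1..<n}. \<phi> \<iota> \<iota>' k m (\<sigma> m)) =
          (\<Prod>j\<in>{1..<n}. differential A x ((G # gs) ! j) (E (key \<iota> j) x))"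
      proof -
        have "\<phi> \<iota> \<iota>' k (n + j) (\<sigma> (n + j)) = differential A x ((G # gs) ! j) (E (key \<iota> j) x)"
          if j: "j \<in> {1..<n}" for j
          unfolding gs(2)[OF j] using j k by (simp add: \<phi>_def K_def)
        then show ?thesis
          by (subst prod.reindex) (simp_all add: comp_def del: nth_Cons_Suc nth_Cons_pos)
      qed
      ultimately show ?thesis
        by (simp add: mult.assoc)
    qed
    have "bracket A P (G # gs) x =
        (\<Sum>\<iota>\<in>I. coef \<iota> * (\<Prod>j<n. differential A x ((G # gs) ! j) (E (key \<iota> j) x)))"
      using expansion[OF x args] gs(1) by (simp add: bracket_def del: list.map)
    also have "\<dots> = (\<Sum>\<iota>\<in>I. coef \<iota> * (DG (E (key \<iota> 0) x c) *
        (\<Prod>j\<in>{1..<n}. differential A x ((G # gs) ! j) (E (key \<iota> j) x))))"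
    proof (rule sum.cong[OF refl])
      fix \<iota> assume \<iota>: "\<iota> \<in> I"
      have "{..<n} = insert 0 {1..<n}"
        using n by auto
      then have "(\<Prod>j<n. differential A x ((G # gs) ! j) (E (key \<iota> j) x)) =
          differential A x ((G # gs) ! 0) (E (key \<iota> 0) x) *
          (\<Prod>j\<in>{1..<n}. differential A x ((G # gs) ! j) (E (key \<iota> j) x))"
        by simp
      then show "coef \<iota> * (\<Prod>j<n. differential A x ((G # gs) ! j) (E (key \<iota> j) x)) =
          coef \<iota> * (DG (E (key \<iota> 0) x c) *
          (\<Prod>j\<in>{1..<n}. differential A x ((G # gs) ! j) (E (key \<iota> j) x)))"
        using dG[OF E_tangent[OF \<iota> n x]] by simp
    qed
    also have "\<dots> = (\<Sum>\<iota>\<in>I. \<Sum>\<iota>'\<in>I. \<Sum>k<n. coef \<iota> * coef \<iota>' *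
        (\<Prod>m\<in>?S. \<phi> \<iota> \<iota>' k m (\<sigma> m)))"
      unfolding DG_def sum_distrib_left sum_distrib_right
      by (intro sum.cong refl, subst prod[symmetric], simp) (simp only: mult_ac)
    finally show ?thesis
      by (simp only: G_def fs_def gs_def)
  qed
  have alt: "(\<Sum>\<sigma> | \<sigma> permutes ?S. of_int (sign \<sigma>) * (\<Prod>m\<in>?S. \<phi> \<iota> \<iota>' k m (\<sigma> m))) = 0"
    if "\<iota> \<in> I" "\<iota>' \<in> I" "k < n" for \<iota> \<iota>' k
  proof -
    from collision[OF that] obtain a b where
      "a \<in> ?S - {k + 1}" "b \<in> ?S - {k + 1}" "a \<noteq> b" "K \<iota> \<iota>' a = K \<iota> \<iota>' b"
      unfolding inj_on_def K_def by blast
    then show ?thesis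
      by (intro alternating_sum_eq_0[of _ a b]) (auto simp: \<phi>_def fun_eq_iff)
  qed
  have "(\<Sum>\<sigma> | \<sigma> permutes ?S. of_int (sign \<sigma>) *
      bracket A P
        (bracket A P (map (\<lambda>i. f (\<sigma> i)) [1..<n+1]) # map (\<lambda>i. f (\<sigma> i)) [n+1..<2*n]) x) =
    (\<Sum>\<sigma> | \<sigma> permutes ?S. \<Sum>\<iota>\<in>I. \<Sum>\<iota>'\<in>I. \<Sum>k<n. coef \<iota> * coef \<iota>' *
      (of_int (sign \<sigma>) * (\<Prod>m\<in>?S. \<phi> \<iota> \<iota>' k m (\<sigma> m))))"
  proof (rule sum.cong[OF refl])
    fix \<sigma> assume "\<sigma> \<in> {\<sigma>. \<sigma> permutes ?S}"
    then show "of_int (sign \<sigma>) * bracket A P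
        (bracket A P (map (\<lambda>i. f (\<sigma> i)) [1..<n+1]) # map (\<lambda>i. f (\<sigma> i)) [n+1..<2*n]) x =
      (\<Sum>\<iota>\<in>I. \<Sum>\<iota>'\<in>I. \<Sum>k<n. coef \<iota> * coef \<iota>' *
        (of_int (sign \<sigma>) * (\<Prod>m\<in>?S. \<phi> \<iota> \<iota>' k m (\<sigma> m))))"
      unfolding mem_Collect_eq by (simp only: double_bracket sum_distrib_left mult.left_commute)
  qed
  also have "\<dots> = (\<Sum>\<iota>\<in>I. \<Sum>\<sigma> | \<sigma> permutes ?S. \<Sum>\<iota>'\<in>I. \<Sum>k<n. coef \<iota> * coef \<iota>' *
      (of_int (sign \<sigma>) * (\<Prod>m\<in>?S. \<phi> \<iota> \<iota>' k m (\<sigma> m))))"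
    by (rule sum.swap)
  also have "\<dots> = (\<Sum>\<iota>\<in>I. \<Sum>\<iota>'\<in>I. \<Sum>\<sigma> | \<sigma> permutes ?S. \<Sum>k<n. coef \<iota> * coef \<iota>' *
      (of_int (sign \<sigma>) * (\<Prod>m\<in>?S. \<phi> \<iota> \<iota>' k m (\<sigma> m))))"
    by (intro sum.cong[OF refl] sum.swap)
  also have "\<dots> = (\<Sum>\<iota>\<in>I. \<Sum>\<iota>'\<in>I. \<Sum>k<n. \<Sum>\<sigma> | \<sigma> permutes ?S. coef \<iota> * coef \<iota>' *
      (of_int (sign \<sigma>) * (\<Prod>m\<in>?S. \<phi> \<iota> \<iota>' k m (\<sigma> m))))"
    by (intro sum.cong[OF refl] sum.swap)
  also have "\<dots> = 0"
  proof -
    have "(\<Sum>\<sigma> | \<sigma> permutes ?S. coef \<iota> * coef \<iota>' *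
        (of_int (sign \<sigma>) * (\<Prod>m\<in>?S. \<phi> \<iota> \<iota>' k m (\<sigma> m)))) = 0"
      if "\<iota> \<in> I" "\<iota>' \<in> I" "k \<in> {..<n}" for \<iota> \<iota>' k
      using alt[of \<iota> \<iota>' k] that unfolding sum_distrib_left[symmetric] by simp
    then show ?thesis
      by (simp only: sum.neutral_const cong: sum.cong)
  qed
  finally show ?thesis .
qed

end

section \<open>Contractions of a sum of products of vector fields\<close>

lemma arg_lists_insert:
  "arg_lists B (Suc k) = (\<lambda>(b, bs). bs @ [b]) ` (B \<times> arg_lists B k)"
proof (intro equalityI subsetI)
  fix xs assume xs: "xs \<in> arg_lists B (Suc k)"
  then have "xs = butlast xs @ [last xs]"
    by (intro append_butlast_last_id[symmetric]) (auto simp: arg_lists_def)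
  moreover have "(last xs, butlast xs) \<in> B \<times> arg_lists B k"
    using xs by (auto simp: arg_lists_def dest: in_set_butlastD intro!: subsetD[OF _ last_in_set])
  ultimately show "xs \<in> (\<lambda>(b, bs). bs @ [b]) ` (B \<times> arg_lists B k)"
    by (metis (no_types, lifting) case_prod_conv image_eqI)
qed (auto simp: arg_lists_def)

lemma sum_arg_lists_prod:
  fixes F :: "nat \<Rightarrow> 'b \<Rightarrow> 'c::comm_semiring_1"
  shows "(\<Sum>xs\<in>arg_lists B k. \<Prod>i<k. F i (xs ! i)) = (\<Prod>i<k. \<Sum>b\<in>B. F i b)"
proof (induction k)
  case 0
  have "arg_lists B 0 = {[]}" by (auto simp: arg_lists_def)
  then show ?case by simp
next
  case (Suc k)
  have "(\<Sum>xs\<in>arg_lists B (Suc k). \<Prod>i<Suc k. F i (xs ! i)) =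
      (\<Sum>(b, bs)\<in>B \<times> arg_lists B k. \<Prod>i<Suc k. F i ((bs @ [b]) ! i))"
    unfolding arg_lists_insert
    by (subst sum.reindex) (auto simp: inj_on_def case_prod_unfold)
  also have "\<dots> = (\<Sum>(b, bs)\<in>B \<times> arg_lists B k. F k b * (\<Prod>i<k. F i (bs ! i)))"
    by (rule sum.cong) (auto simp: arg_lists_def nth_append mult.commute)
  also have "\<dots> = (\<Sum>b\<in>B. F k b) * (\<Sum>bs\<in>arg_lists B k. \<Prod>i<k. F i (bs ! i))"
    by (simp add: sum.cartesian_product[symmetric] sum_product)
  finally show ?case
    by (simp add: Suc.IH mult.commute)
qed

text \<open>The product \<open>\<theta>\<^sub>0 \<and> \<dots> \<and> \<theta>\<^bsub>k-1\<^esub>\<close> of linear functionals.\<close>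

definition det_form :: "nat \<Rightarrow> (nat \<Rightarrow> 'v \<Rightarrow> real) \<Rightarrow> 'v list \<Rightarrow> real" where
  "det_form k \<theta> us =
     (\<Sum>q | q permutes {..<k}. of_int (sign q) * (\<Prod>i<k. \<theta> (q i) (us ! i)))"

lemma alternating_on_det_form:
  assumes lin: "\<And>i. linear (\<theta> i)"
  shows "alternating_on S k (det_form k \<theta>)"
proof -
  have upd: "det_form k \<theta> (xs[i := u]) = (\<Sum>q | q permutes {..<k}.
      of_int (sign q) * (\<theta> (q i) u * (\<Prod>j\<in>{..<k} - {i}. \<theta> (q j) (xs ! j))))"
    if xs: "length xs = k" "i < k" for xs i u
  proof -
    have "(\<Prod>j<k. \<theta> (q j) (xs[i := u] ! j)) =
        \<theta> (q i) u * (\<Prod>j\<in>{..<k} - {i}. \<theta> (q j) (xs ! j))" for q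
      using xs by (subst prod.remove[of _ i]) (auto intro!: prod.cong)
    then show ?thesis
      by (simp add: det_form_def)
  qed
  show ?thesis
    unfolding alternating_on_def
  proof (intro conjI ballI allI impI)
    fix xs i j assume xs: "xs \<in> arg_lists S k" and ij: "i < k" "j < k" "i \<noteq> j \<and> xs ! i = xs ! j"
    have "(\<Sum>q | q permutes {..<k}. of_int (sign q) * (\<Prod>m\<in>{..<k}. (\<lambda>m l. \<theta> l (xs ! m)) m (q m))) = 0"
      by (rule alternating_sum_eq_0[of _ i j]) (use ij in auto)
    then show "det_form k \<theta> xs = 0"
      by (simp add: det_form_def)
  qed (auto simp: arg_lists_def upd linear_add[OF lin] linear_scale[OF lin] sum.distrib[symmetric]
      sum_distrib_left algebra_simps)
qed

context local_frame_expansion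
begin

text \<open>The coordinate sum over the free index \<open>b\<close> reassembles the vector at the last position of each
  term, so a contraction only produces vectors that occur in last position.\<close>

lemma contraction_expansion:
  assumes x: "x \<in> U" and n: "n > 0"
  shows "contraction A x n \<omega> (P x) = (\<Sum>\<iota>\<in>I. (coef \<iota> *
      (\<Sum>as\<in>arg_lists Basis (n - 1). \<omega> (map (coord_vec A (chart_at A x) x) as) *
        (\<Prod>k<n-1. E (key \<iota> k) x (chart_at A x) \<bullet> (as ! k))) / fact (n - 1)) *\<^sub>R
      E (key \<iota> (n - 1)) x)"
proof -
  define c where "c = chart_at A x"
  have c: "c \<in> charts_at A x"
    unfolding c_def by (rule chart_at_in[OF U_topspace[OF x]])
  let ?a = "\<lambda>as. map (coord_covec A c x) as"
  define w where "w as = \<omega> (map (coord_vec A c x) as)" for as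
  define p where "p \<iota> as = (\<Prod>k<n-1. E (key \<iota> k) x c \<bullet> (as ! k))" for \<iota> and as :: "'e list"
  have P: "P x (?a as @ [coord_covec A c x b]) =
      (\<Sum>\<iota>\<in>I. coef \<iota> * p \<iota> as * (E (key \<iota> (n - 1)) x c \<bullet> b))"
    if as: "as \<in> arg_lists Basis (n - 1)" for as b
  proof -
    let ?as = "?a as @ [coord_covec A c x b]"
    have len: "length as = n - 1"
      using as by (simp add: arg_lists_def)
    have "?as \<in> arg_lists (cotangent_space A x) n"
      using len n by (auto simp: arg_lists_def coord_covec_in_cotangent_space)
    note expansion[OF x this]
    also have "(\<Sum>\<iota>\<in>I. coef \<iota> * (\<Prod>k<n. (?as ! k) (E (key \<iota> k) x))) =
        (\<Sum>\<iota>\<in>I. coef \<iota> * p \<iota> as * (E (key \<iota> (n - 1)) x c \<bullet> b))"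
    proof (rule sum.cong[OF refl])
      fix \<iota> assume \<iota>: "\<iota> \<in> I"
      have "(\<Prod>k<n. (?as ! k) (E (key \<iota> k) x)) =
          (\<Prod>k<n-1. (?as ! k) (E (key \<iota> k) x)) * (?as ! (n - 1)) (E (key \<iota> (n - 1)) x)"
        using n by (cases n) simp_all
      also have "(\<Prod>k<n-1. (?as ! k) (E (key \<iota> k) x)) = p \<iota> as"
        unfolding p_def using len E_tangent[OF \<iota> _ x]
        by (intro prod.cong) (auto simp: nth_append coord_covec_def)
      also have "(?as ! (n - 1)) (E (key \<iota> (n - 1)) x) = E (key \<iota> (n - 1)) x c \<bullet> b"
        using len E_tangent[OF \<iota> _ x, of "n - 1"] n by (simp add: nth_append coord_covec_def)
      finally show "coef \<iota> * (\<Prod>k<n. (?as ! k) (E (key \<iota> k) x)) =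
          coef \<iota> * p \<iota> as * (E (key \<iota> (n - 1)) x c \<bullet> b)"
        by simp
    qed
    finally show ?thesis .
  qed
  have "contraction A x n \<omega> (P x) = (\<Sum>b\<in>Basis. ((\<Sum>as\<in>arg_lists Basis (n - 1). w as *
      (\<Sum>\<iota>\<in>I. coef \<iota> * p \<iota> as * (E (key \<iota> (n - 1)) x c \<bullet> b))) / fact (n - 1)) *\<^sub>R
      coord_vec A c x b)"
    unfolding contraction_def Let_def c_def[symmetric] w_def by (simp add: P)
  also have "\<dots> = (\<Sum>b\<in>Basis. \<Sum>\<iota>\<in>I. ((coef \<iota> * (\<Sum>as\<in>arg_lists Basis (n - 1). w as * p \<iota> as) /
      fact (n - 1)) * (E (key \<iota> (n - 1)) x c \<bullet> b)) *\<^sub>R coord_vec A c x b)"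
  proof (rule sum.cong[OF refl])
    fix b :: 'e
    have "(\<Sum>as\<in>arg_lists Basis (n - 1). w as *
        (\<Sum>\<iota>\<in>I. coef \<iota> * p \<iota> as * (E (key \<iota> (n - 1)) x c \<bullet> b))) =
      (\<Sum>as\<in>arg_lists Basis (n - 1). \<Sum>\<iota>\<in>I.
        coef \<iota> * (w as * p \<iota> as) * (E (key \<iota> (n - 1)) x c \<bullet> b))"
      by (simp add: sum_distrib_left mult_ac)
    also have "\<dots> = (\<Sum>\<iota>\<in>I. \<Sum>as\<in>arg_lists Basis (n - 1).
        coef \<iota> * (w as * p \<iota> as) * (E (key \<iota> (n - 1)) x c \<bullet> b))"
      by (rule sum.swap)
    also have "\<dots> = (\<Sum>\<iota>\<in>I. coef \<iota> * (\<Sum>as\<in>arg_lists Basis (n - 1). w as * p \<iota> as) *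
        (E (key \<iota> (n - 1)) x c \<bullet> b))"
      by (simp add: sum_distrib_left sum_distrib_right)
    finally show "((\<Sum>as\<in>arg_lists Basis (n - 1). w as *
        (\<Sum>\<iota>\<in>I. coef \<iota> * p \<iota> as * (E (key \<iota> (n - 1)) x c \<bullet> b))) / fact (n - 1)) *\<^sub>R
        coord_vec A c x b =
      (\<Sum>\<iota>\<in>I. ((coef \<iota> * (\<Sum>as\<in>arg_lists Basis (n - 1). w as * p \<iota> as) /
        fact (n - 1)) * (E (key \<iota> (n - 1)) x c \<bullet> b)) *\<^sub>R coord_vec A c x b)"
      by (simp add: sum_divide_distrib scaleR_sum_left)
  qed
  also have "\<dots> = (\<Sum>\<iota>\<in>I. \<Sum>b\<in>Basis. ((coef \<iota> * (\<Sum>as\<in>arg_lists Basis (n - 1). w as * p \<iota> as) /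
      fact (n - 1)) * (E (key \<iota> (n - 1)) x c \<bullet> b)) *\<^sub>R coord_vec A c x b)"
    by (rule sum.swap)
  also have "\<dots> = (\<Sum>\<iota>\<in>I. (coef \<iota> * (\<Sum>as\<in>arg_lists Basis (n - 1). w as * p \<iota> as) /
      fact (n - 1)) *\<^sub>R E (key \<iota> (n - 1)) x)"
  proof (rule sum.cong[OF refl])
    fix \<iota> assume "\<iota> \<in> I"
    then have "(\<Sum>b\<in>Basis. (E (key \<iota> (n - 1)) x c \<bullet> b) *\<^sub>R coord_vec A c x b) =
        E (key \<iota> (n - 1)) x"
      using n x by (intro tangent_vector_expansion[OF E_tangent c]) auto
    then show "(\<Sum>b\<in>Basis. ((coef \<iota> * (\<Sum>as\<in>arg_lists Basis (n - 1). w as * p \<iota> as) /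
        fact (n - 1)) * (E (key \<iota> (n - 1)) x c \<bullet> b)) *\<^sub>R coord_vec A c x b) =
      (coef \<iota> * (\<Sum>as\<in>arg_lists Basis (n - 1). w as * p \<iota> as) / fact (n - 1)) *\<^sub>R
        E (key \<iota> (n - 1)) x"
      unfolding scaleR_scaleR[symmetric] scaleR_sum_right[symmetric] by simp
  qed
  finally show ?thesis
    unfolding w_def p_def c_def .
qed

text \<open>Likewise, the coordinate sums over the other indices reassemble the vectors at the other
  positions, once the sum over index lists is turned into a product of sums.\<close>

lemma contraction_det_form:
  assumes x: "x \<in> U" and n: "n > 0" and lin: "\<And>i. linear (\<theta> i)"
  shows "contraction A x n (det_form (n - 1) \<theta>) (P x) =
    (\<Sum>\<iota>\<in>I. (coef \<iota> * (\<Sum>q | q permutes {..<n-1}. of_int (sign q) *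
      (\<Prod>k<n-1. \<theta> (q k) (E (key \<iota> k) x))) / fact (n - 1)) *\<^sub>R E (key \<iota> (n - 1)) x)"
proof -
  define c where "c = chart_at A x"
  have c: "c \<in> charts_at A x"
    unfolding c_def by (rule chart_at_in[OF U_topspace[OF x]])
  have "(\<Sum>as\<in>arg_lists Basis (n - 1). det_form (n - 1) \<theta> (map (coord_vec A c x) as) *
        (\<Prod>k<n-1. E (key \<iota> k) x c \<bullet> (as ! k))) =
      (\<Sum>q | q permutes {..<n-1}. of_int (sign q) * (\<Prod>k<n-1. \<theta> (q k) (E (key \<iota> k) x)))"
    if \<iota>: "\<iota> \<in> I" for \<iota>
  proof -
    let ?v = "\<lambda>k. E (key \<iota> k) x"
    have "(\<Sum>as\<in>arg_lists Basis (n - 1). det_form (n - 1) \<theta> (map (coord_vec A c x) as) *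
        (\<Prod>k<n-1. ?v k c \<bullet> (as ! k))) =
      (\<Sum>as\<in>arg_lists Basis (n - 1). \<Sum>q | q permutes {..<n-1}. of_int (sign q) *
        (\<Prod>k<n-1. (?v k c \<bullet> (as ! k)) * \<theta> (q k) (coord_vec A c x (as ! k))))"
    proof (rule sum.cong[OF refl])
      fix as :: "'e list" assume "as \<in> arg_lists Basis (n - 1)"
      then have len: "length as = n - 1"
        by (simp add: arg_lists_def)
      then have "(\<Prod>k<n-1. \<theta> (q k) (map (coord_vec A c x) as ! k)) =
          (\<Prod>k<n-1. \<theta> (q k) (coord_vec A c x (as ! k)))" for q
        by (intro prod.cong) auto
      then show "det_form (n - 1) \<theta> (map (coord_vec A c x) as) * (\<Prod>k<n-1. ?v k c \<bullet> (as ! k)) =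
          (\<Sum>q | q permutes {..<n-1}. of_int (sign q) *
            (\<Prod>k<n-1. (?v k c \<bullet> (as ! k)) * \<theta> (q k) (coord_vec A c x (as ! k))))"
        unfolding det_form_def sum_distrib_right prod.distrib by (simp add: mult_ac)
    qed
    also have "\<dots> = (\<Sum>q | q permutes {..<n-1}. \<Sum>as\<in>arg_lists Basis (n - 1). of_int (sign q) *
        (\<Prod>k<n-1. (?v k c \<bullet> (as ! k)) * \<theta> (q k) (coord_vec A c x (as ! k))))"
      by (rule sum.swap)
    also have "\<dots> = (\<Sum>q | q permutes {..<n-1}. of_int (sign q) *
        (\<Prod>k<n-1. \<Sum>b\<in>Basis. (?v k c \<bullet> b) * \<theta> (q k) (coord_vec A c x b)))"
      unfolding sum_distrib_left[symmetric]
      by (simp only: sum_arg_lists_prod[of "\<lambda>k b. (?v k c \<bullet> b) * \<theta> (_ k) (coord_vec A c x b)"])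
    also have "\<dots> = (\<Sum>q | q permutes {..<n-1}. of_int (sign q) * (\<Prod>k<n-1. \<theta> (q k) (?v k)))"
    proof -
      have "(\<Sum>b\<in>Basis. (?v k c \<bullet> b) * \<theta> l (coord_vec A c x b)) = \<theta> l (?v k)"
        if k: "k < n - 1" for k l
      proof -
        have "k < n" using k by simp
        then have "?v k = (\<Sum>b\<in>Basis. (?v k c \<bullet> b) *\<^sub>R coord_vec A c x b)"
          by (intro tangent_vector_expansion[OF E_tangent c, symmetric] \<iota> x)
        then have "\<theta> l (?v k) = \<theta> l (\<Sum>b\<in>Basis. (?v k c \<bullet> b) *\<^sub>R coord_vec A c x b)"
          by (rule arg_cong)
        then show ?thesis
          by (simp add: linear_sum[OF lin] linear_scale[OF lin])
      qed
      then show ?thesis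
        by (intro sum.cong refl arg_cong2[where f="(*)"] prod.cong) auto
    qed
    finally show ?thesis .
  qed
  then show ?thesis
    unfolding contraction_expansion[OF x n] c_def[symmetric] by simp
qed

end

section \<open>Positions of the two frames in the expansion\<close>

text \<open>Writing out the wedge products as well, the terms of \<open>P\<close> are indexed by pairs of permutations:
  \<open>\<sigma>\<close> distributes the indices over the \<open>n\<close> slots, of which the first \<open>h\<close> hold \<open>V\<close>'s, and \<open>p\<close>
  tells which slot is evaluated at which argument. The key of a position is its letter (\<open>True\<close> for
  \<open>V\<close>) and its index; slots and arguments are numbered from \<open>0\<close>, indices from \<open>1\<close>.\<close>

definition frame_key :: "nat \<Rightarrow> (nat \<Rightarrow> nat) \<times> (nat \<Rightarrow> nat) \<Rightarrow> nat \<Rightarrow> bool \<times> nat" where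
  "frame_key h = (\<lambda>(\<sigma>, p) k. (p k < h, \<sigma> (Suc (p k))))"

lemma frame_key_index:
  assumes "\<sigma> permutes {1..n}" "p permutes {..<n}" "k < n"
  shows "snd (frame_key h (\<sigma>, p) k) \<in> {1..n}"
proof -
  have "p k < n"
    using permutes_in_image[OF assms(2), of k] assms(3) by simp
  then show ?thesis
    using permutes_in_image[OF assms(1), of "Suc (p k)"] by (simp add: frame_key_def)
qed

lemma card_first_positions_le:
  fixes p :: "nat \<Rightarrow> nat"
  assumes "p permutes {..<n}"
  shows "card {j. j < n \<and> p j < h} \<le> h"
proof -
  have "card (p ` {j. j < n \<and> p j < h}) \<le> card {..<h}"
    by (rule card_mono) auto
  then show ?thesis
    using permutes_inj_on[OF assms] by (simp add: card_image)
qed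

text \<open>This is where \<open>2h \<le> n - 3\<close> is needed: each of the two terms contributes at most \<open>h\<close> letters \<open>V\<close>,
  so at least \<open>2n - 2 - 2h \<ge> n + 1\<close> of the \<open>2n - 2\<close> positions carry a \<open>W\<close>, for which there are
  only \<open>n\<close> indices.\<close>

lemma frame_key_collision:
  assumes h: "2 * h \<le> n - 3" and n: "n \<ge> 3" and k: "k < n"
    and \<iota>: "\<sigma> permutes {1..n}" "p permutes {..<n}"
    and \<iota>': "\<sigma>' permutes {1..n}" "p' permutes {..<n}"
  shows "\<not> inj_on (\<lambda>m. if m \<le> n then frame_key h (\<sigma>', p') (m - 1) else frame_key h (\<sigma>, p) (m - n))
    ({1..2*n-1} - {k + 1})" (is "\<not> inj_on ?\<kappa> _")
proof
  assume inj: "inj_on ?\<kappa> ({1..2*n-1} - {k + 1})"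
  \<comment> \<open>\<open>T\<close> contains the positions with letter \<open>V\<close>, hence all of \<open>B\<close> carries the letter \<open>W\<close>.\<close>
  define T where "T = Suc ` {j. j < n \<and> p' j < h} \<union> (+) n ` {j. j < n \<and> p j < h}"
  define B where "B = {1..2*n-1} - {k + 1} - T"
  have "card T \<le> card (Suc ` {j. j < n \<and> p' j < h}) + card ((+) n ` {j. j < n \<and> p j < h})"
    unfolding T_def by (rule card_Un_le)
  also have "\<dots> \<le> h + h"
    using card_first_positions_le[OF \<iota>(2), of h] card_first_positions_le[OF \<iota>'(2), of h]
    by (simp add: card_image)
  finally have "card T \<le> 2 * h"
    by simp
  moreover have "card ({1..2*n-1} - {k + 1}) = 2 * n - 2"
    using k by (subst card_Diff_subset) auto
  moreover have "finite T"
    unfolding T_def by simp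
  ultimately have "2 * n - 2 - 2 * h \<le> card B"
    using diff_card_le_card_Diff[of T "{1..2*n-1} - {k + 1}"] unfolding B_def by linarith
  then have "n < card B"
    using h n by linarith
  moreover have "?\<kappa> ` B \<subseteq> {False} \<times> {1..n}"
  proof
    fix y assume "y \<in> ?\<kappa> ` B"
    then obtain m where m: "m \<in> B" "y = ?\<kappa> m"
      by blast
    show "y \<in> {False} \<times> {1..n}"
    proof (cases "m \<le> n")
      case True
      then have *: "m = Suc (m - 1)" "m - 1 < n"
        using m(1) by (auto simp: B_def)
      then have "\<not> p' (m - 1) < h"
        using m(1) unfolding B_def T_def by blast
      then show ?thesis
        using True m(2) frame_key_index[OF \<iota>' *(2), of h] by (simp add: frame_key_def)
    next
      case False
      then have *: "m = n + (m - n)" "m - n < n"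
        using m(1) by (auto simp: B_def)
      then have "\<not> p (m - n) < h"
        using m(1) unfolding B_def T_def by blast
      then show ?thesis
        using False m(2) frame_key_index[OF \<iota> *(2), of h] by (simp add: frame_key_def)
    qed
  qed
  then have "card (?\<kappa> ` B) \<le> card ({False} \<times> {1..n})"
    by (rule card_mono[rotated]) simp
  moreover have "card (?\<kappa> ` B) = card B"
    by (rule card_image, rule inj_on_subset[OF inj]) (auto simp: B_def)
  ultimately show False
    by simp
qed

lemma sum_permutes_last_eq:
  fixes g g' :: "nat \<Rightarrow> nat"
  assumes "n > 0" and "(\<Sum>k<n. g k) = (\<Sum>k<n. g' k)" and "\<And>k. k < n - 1 \<Longrightarrow> g k = g' k"
  shows "g (n - 1) = g' (n - 1)"
  using assms by (cases n) auto

text \<open>If two terms agree up to a rearrangement \<open>q\<close> in all positions but the last, they agree in the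
  last one: in every term all indices occur once and equally many letters are \<open>V\<close>, so the last
  position is determined by the sum of the indices and the number of \<open>V\<close>'s. The index permutations
  \<open>\<sigma> p\<close> and \<open>\<sigma>\<^sub>0 p\<^sub>0 q\<close> are then equal, whence the statement about signs.\<close>

lemma frame_key_rigid:
  assumes n: "n > 0"
    and \<iota>: "\<sigma> permutes {1..n}" "p permutes {..<n}"
    and \<iota>0: "\<sigma>0 permutes {1..n}" "p0 permutes {..<n}"
    and q: "q permutes {..<n-1}"
    and eq: "\<And>k. k < n - 1 \<Longrightarrow> frame_key h (\<sigma>, p) k = frame_key h (\<sigma>0, p0) (q k)"
  shows "frame_key h (\<sigma>, p) (n - 1) = frame_key h (\<sigma>0, p0) (n - 1)"
    and "sign \<sigma> * sign p * sign q = sign \<sigma>0 * sign p0"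
proof -
  define p1 where "p1 = p0 \<circ> q"
  have q': "q permutes {..<n}"
    by (rule permutes_subset[OF q]) auto
  have q_last: "q (n - 1) = n - 1"
    using permutes_not_in[OF q] by simp
  have p1: "p1 permutes {..<n}"
    unfolding p1_def by (rule permutes_compose[OF q' \<iota>0(2)])
  have eq1: "p k < h \<longleftrightarrow> p1 k < h" "\<sigma> (Suc (p k)) = \<sigma>0 (Suc (p1 k))" if "k < n - 1" for k
    using eq[OF that] unfolding frame_key_def p1_def by auto
  have sum_perm: "(\<Sum>k<n. g (r k)) = (\<Sum>k<n. g k)" if "r permutes {..<n}" for r and g :: "nat \<Rightarrow> nat"
    using sum.permute[OF that, of g] unfolding comp_def by (rule sym)
  have sum_perm_Suc: "(\<Sum>k<n. s (Suc (r k))) = (\<Sum>k\<in>{1..n}. k)"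
    if "s permutes {1..n}" "r permutes {..<n}" for s r
  proof -
    have "(\<Sum>k<n. s (Suc (r k))) = (\<Sum>k<n. s (Suc k))"
      by (rule sum_perm[OF that(2)])
    also have "\<dots> = (\<Sum>k\<in>Suc ` {..<n}. s k)"
      by (simp add: sum.reindex)
    also have "Suc ` {..<n} = {1..n}"
      by (simp add: image_Suc_lessThan)
    also have "(\<Sum>k\<in>{1..n}. s k) = (\<Sum>k\<in>{1..n}. k)"
      using sum.permute[OF that(1), of "\<lambda>k. k"] unfolding comp_def by (rule sym)
    finally show ?thesis .
  qed
  have last1: "p (n - 1) < h \<longleftrightarrow> p1 (n - 1) < h"
  proof -
    let ?b = "\<lambda>j. of_bool (j < h) :: nat"
    have "?b (p (n - 1)) = ?b (p1 (n - 1))"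
    proof (rule sum_permutes_last_eq[OF n, of "\<lambda>k. ?b (p k)" "\<lambda>k. ?b (p1 k)"])
      show "(\<Sum>k<n. ?b (p k)) = (\<Sum>k<n. ?b (p1 k))"
        unfolding sum_perm[OF \<iota>(2), of ?b] sum_perm[OF p1, of ?b] ..
      show "?b (p k) = ?b (p1 k)" if "k < n - 1" for k
        using eq1(1)[OF that] by (rule arg_cong)
    qed
    then show ?thesis
      unfolding of_bool_eq_iff .
  qed
  have last2: "\<sigma> (Suc (p (n - 1))) = \<sigma>0 (Suc (p1 (n - 1)))"
  proof (rule sum_permutes_last_eq[OF n, of "\<lambda>k. \<sigma> (Suc (p k))" "\<lambda>k. \<sigma>0 (Suc (p1 k))"])
    show "(\<Sum>k<n. \<sigma> (Suc (p k))) = (\<Sum>k<n. \<sigma>0 (Suc (p1 k)))"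
      unfolding sum_perm_Suc[OF \<iota>] sum_perm_Suc[OF \<iota>0(1) p1] ..
  qed (rule eq1(2))
  show "frame_key h (\<sigma>, p) (n - 1) = frame_key h (\<sigma>0, p0) (n - 1)"
    using last1 last2 q_last by (auto simp: frame_key_def p1_def split: if_splits)
  have all: "\<sigma> (Suc (p k)) = \<sigma>0 (Suc (p1 k))" if "k < n" for k
  proof (cases "k = n - 1")
    case True
    show ?thesis unfolding True by (rule last2)
  next
    case False
    with that have "k < n - 1" by linarith
    then show ?thesis by (rule eq1(2))
  qed
  \<comment> \<open>Slots are shifted by one against indices, so permutations of slots have to be transported
    along \<^const>\<open>Suc\<close> before they can be composed with permutations of indices.\<close>
  let ?M = "map_permutation {..<n} Suc"
  have M: "?M r permutes {1..n}" "sign (?M r) = sign r" if "r permutes {..<n}" for r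
    using map_permutation_permutes[OF _ that, of Suc "{1..n}"] sign_map_permutation[OF _ that, of Suc]
    by (simp_all add: bij_betw_def image_Suc_lessThan)
  have perm: "permutation r" if "r permutes {1..n}" for r
    using permutes_imp_permutation[OF _ that] by simp
  have "\<sigma> \<circ> ?M p = \<sigma>0 \<circ> ?M p1"
  proof
    fix m
    show "(\<sigma> \<circ> ?M p) m = (\<sigma>0 \<circ> ?M p1) m"
    proof (cases "m \<in> {1..n}")
      case True
      then obtain k where k: "m = Suc k" "k < n"
        by (cases m) auto
      then show ?thesis
        using all[OF k(2)] by (simp add: map_permutation_apply)
    next
      case False
      show ?thesis
        unfolding comp_def permutes_not_in[OF M(1)[OF \<iota>(2)] False]
          permutes_not_in[OF M(1)[OF p1] False] permutes_not_in[OF \<iota>(1) False]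
          permutes_not_in[OF \<iota>0(1) False] ..
    qed
  qed
  moreover have "sign (\<sigma> \<circ> ?M p) = sign \<sigma> * sign p"
    unfolding sign_compose[OF perm[OF \<iota>(1)] perm[OF M(1)[OF \<iota>(2)]]] M(2)[OF \<iota>(2)] ..
  moreover have "sign (\<sigma>0 \<circ> ?M p1) = sign \<sigma>0 * sign p1"
    unfolding sign_compose[OF perm[OF \<iota>0(1)] perm[OF M(1)[OF p1]]] M(2)[OF p1] ..
  moreover have "sign p1 = sign p0 * sign q"
    unfolding p1_def
    by (intro sign_compose permutes_imp_permutation[OF finite_lessThan \<iota>0(2)]
        permutes_imp_permutation[OF finite_lessThan q'])
  ultimately have "sign \<sigma> * sign p = sign \<sigma>0 * sign p0 * sign q"
    by (metis mult.assoc)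
  then have "sign \<sigma> * sign p * sign q = sign \<sigma>0 * sign p0 * (sign q * sign q)"
    by (metis mult.assoc)
  then show "sign \<sigma> * sign p * sign q = sign \<sigma>0 * sign p0"
    unfolding sign_idempotent by simp
qed

lemma frame_key_last_surj:
  assumes h: "h < n" and \<kappa>: "snd \<kappa> \<in> {1..n}" "fst \<kappa> \<longrightarrow> h > 0"
  obtains \<sigma> p where "\<sigma> permutes {1..n}" "p permutes {..<n}" "frame_key h (\<sigma>, p) (n - 1) = \<kappa>"
proof -
  \<comment> \<open>A slot of the right letter: the first one for \<open>V\<close>, the last one for \<open>W\<close>.\<close>
  define r where "r = (if fst \<kappa> then 0 else n - 1)"
  have r: "r < n" "r < h \<longleftrightarrow> fst \<kappa>"
    using h \<kappa> by (auto simp: r_def)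
  show thesis
  proof (rule that)
    show "Transposition.transpose (Suc r) (snd \<kappa>) permutes {1..n}"
      by (rule permutes_swap_id) (use r \<kappa> in auto)
    show "Transposition.transpose (n - 1) r permutes {..<n}"
      by (rule permutes_swap_id) (use r in auto)
    show "frame_key h (Transposition.transpose (Suc r) (snd \<kappa>), Transposition.transpose (n - 1) r)
        (n - 1) = \<kappa>"
      using r by (simp add: frame_key_def prod_eq_iff)
  qed
qed

lemma independent_family:
  fixes v :: "'k \<Rightarrow> 'v::real_vector"
  assumes K: "finite K" and v: "\<And>a \<kappa>. (\<Sum>\<kappa>\<in>K. a \<kappa> *\<^sub>R v \<kappa>) = 0 \<Longrightarrow> \<kappa> \<in> K \<Longrightarrow> a \<kappa> = (0::real)"
  shows "inj_on v K" and "independent (v ` K)"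
proof -
  show inj: "inj_on v K"
  proof (rule inj_onI, rule ccontr)
    fix \<kappa> l assume *: "\<kappa> \<in> K" "l \<in> K" "v \<kappa> = v l" "\<kappa> \<noteq> l"
    let ?a = "\<lambda>j. (if j = \<kappa> then 1 else 0) - (if j = l then 1 else 0) :: real"
    have "(\<Sum>j\<in>K. ?a j *\<^sub>R v j) =
        (\<Sum>j\<in>K. if j = \<kappa> then v j else 0) - (\<Sum>j\<in>K. if j = l then v j else 0)"
      unfolding sum_subtractf[symmetric] by (rule sum.cong) auto
    also have "\<dots> = 0"
      using * K by (simp add: sum.delta)
    finally have "?a \<kappa> = 0"
      using *(1) by (rule v)
    then show False
      using *(4) by simp
  qed
  show "independent (v ` K)"
  proof (rule independent_if_scalars_zero)
    fix f x assume "(\<Sum>x\<in>v ` K. f x *\<^sub>R x) = 0" and x: "x \<in> v ` K"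
    then have "(\<Sum>\<kappa>\<in>K. f (v \<kappa>) *\<^sub>R v \<kappa>) = 0"
      by (simp add: sum.reindex[OF inj])
    from v[OF this] show "f x = 0"
      using x by auto
  qed (use K in simp)
qed

lemma dual_functional:
  fixes v :: "'k \<Rightarrow> 'v::real_vector"
  assumes "inj_on v K" "independent (v ` K)" "\<kappa> \<in> K"
  obtains \<theta> :: "'v \<Rightarrow> real" where "linear \<theta>" "\<And>l. l \<in> K \<Longrightarrow> \<theta> (v l) = (if l = \<kappa> then 1 else 0)"
proof -
  obtain \<theta> where \<theta>: "linear \<theta>" "\<forall>x\<in>v ` K. \<theta> x = (if x = v \<kappa> then 1 else 0 :: real)"
    using linear_independent_extend[OF assms(2), of "\<lambda>x. if x = v \<kappa> then 1 else 0 :: real"] by blast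
  show thesis
  proof (rule that[OF \<theta>(1)])
    fix l assume l: "l \<in> K"
    then show "\<theta> (v l) = (if l = \<kappa> then 1 else 0)"
      using \<theta>(2) inj_onD[OF assms(1) _ l assms(3)] by auto
  qed
qed

section \<open>Multivectors built from two frames\<close>

locale two_frame_multivector = smooth_atlas X A
  for X :: "'a topology" and A :: "('a, 'e::euclidean_space) chart set" +
  fixes U :: "'a set" and n h :: nat and P :: "'a \<Rightarrow> ('a, 'e) mvec"
    and V W :: "nat \<Rightarrow> 'a \<Rightarrow> ('a, 'e) tvec"
  assumes open_U: "openin X U"
    and n: "n \<ge> 3" and h: "2 * h \<le> n - 3"
    and smooth_V: "i \<in> {1..n} \<Longrightarrow> smooth_vector_field_on A U (V i)"
    and smooth_W: "i \<in> {1..n} \<Longrightarrow> smooth_vector_field_on A U (W i)"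
    and independent_VW: "y \<in> U \<Longrightarrow> (\<Sum>i=1..n. a i *\<^sub>R V i y) + (\<Sum>i=1..n. b i *\<^sub>R W i y) = 0 \<Longrightarrow>
      i \<in> {1..n} \<Longrightarrow> a i = (0::real) \<and> b i = (0::real)"
    and P_eq: "y \<in> U \<Longrightarrow> \<alpha>s \<in> arg_lists (cotangent_space A y) n \<Longrightarrow>
      P y \<alpha>s = 1 / (fact h * fact (n - h)) *
        (\<Sum>\<sigma> | \<sigma> permutes {1..n}. of_int (sign \<sigma>) *
          wedge (map (\<lambda>i. V (\<sigma> i) y) [1..<h+1] @ map (\<lambda>i. W (\<sigma> i) y) [h+1..<n+1]) \<alpha>s)"
begin

definition frame :: "bool \<times> nat \<Rightarrow> 'a \<Rightarrow> ('a, 'e) tvec" where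
  "frame = (\<lambda>(b, i). if b then V i else W i)"

abbreviation perm_pairs :: "((nat \<Rightarrow> nat) \<times> (nat \<Rightarrow> nat)) set" where
  "perm_pairs \<equiv> {\<sigma>. \<sigma> permutes {1..n}} \<times> {p. p permutes {..<n}}"

definition coefficient :: "(nat \<Rightarrow> nat) \<times> (nat \<Rightarrow> nat) \<Rightarrow> real" where
  "coefficient = (\<lambda>(\<sigma>, p). 1 / (fact h * fact (n - h)) * (of_int (sign \<sigma>) * of_int (sign p)))"

lemma smooth_frame: "snd \<kappa> \<in> {1..n} \<Longrightarrow> smooth_vector_field_on A U (frame \<kappa>)"
  using smooth_V smooth_W by (cases \<kappa>) (simp add: frame_def)

lemma wedge_frame:
  "wedge (map (\<lambda>i. V (\<sigma> i) y) [1..<h+1] @ map (\<lambda>i. W (\<sigma> i) y) [h+1..<n+1]) \<alpha>s =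
    (\<Sum>p | p permutes {..<n}. of_int (sign p) *
      (\<Prod>k<n. (\<alpha>s ! k) (frame (frame_key h (\<sigma>, p) k) y)))"
proof -
  let ?vs = "map (\<lambda>i. V (\<sigma> i) y) [1..<h+1] @ map (\<lambda>i. W (\<sigma> i) y) [h+1..<n+1]"
  have len: "length ?vs = n"
    using h n by (simp del: upt_Suc)
  have nth: "?vs ! j = frame (j < h, \<sigma> (Suc j)) y" if "j < n" for j
  proof (cases "j < h")
    case True
    then show ?thesis
      by (simp add: nth_append frame_def del: upt_Suc)
  next
    case False
    then have "[h+1..<n+1] ! (j - h) = Suc j"
      using that by (subst nth_upt) auto
    then show ?thesis
      using False that by (simp add: nth_append frame_def del: upt_Suc)
  qed
  show ?thesis
    unfolding wedge_def len
  proof (intro sum.cong refl arg_cong2[where f="(*)"] prod.cong)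
    fix p k assume "p \<in> {p. p permutes {..<n}}" "k \<in> {..<n}"
    then have "p k < n"
      using permutes_in_image[of p "{..<n}" k] by simp
    then show "(\<alpha>s ! k) (?vs ! p k) = (\<alpha>s ! k) (frame (frame_key h (\<sigma>, p) k) y)"
      unfolding nth[OF \<open>p k < n\<close>] frame_key_def by simp
  qed
qed

lemma P_expansion:
  assumes "y \<in> U" "\<alpha>s \<in> arg_lists (cotangent_space A y) n"
  shows "P y \<alpha>s = (\<Sum>\<iota>\<in>perm_pairs. coefficient \<iota> *
    (\<Prod>k<n. (\<alpha>s ! k) (frame (frame_key h \<iota> k) y)))"
  unfolding P_eq[OF assms] wedge_frame sum.cartesian_product' sum_distrib_left
  by (simp add: coefficient_def mult.assoc)

sublocale local_frame_expansion X A U n P perm_pairs coefficient "frame_key h" frame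
proof
  show "finite perm_pairs"
    by (simp add: finite_permutations)
  show "smooth_vector_field_on A U (frame (frame_key h \<iota> k))" if "\<iota> \<in> perm_pairs" "k < n" for \<iota> k
    using smooth_frame frame_key_index[of "fst \<iota>" n "snd \<iota>" k h] that by (auto simp: mem_Times_iff)
qed (fact open_U P_expansion)+

lemma jacobi_identity:
  assumes "x \<in> U" and "\<And>i. i \<in> {1..2*n-1} \<Longrightarrow> smooth_function A (f i)"
  shows "(\<Sum>\<sigma> | \<sigma> permutes {1..2*n-1}. of_int (sign \<sigma>) *
      bracket A P
        (bracket A P (map (\<lambda>i. f (\<sigma> i)) [1..<n+1]) # map (\<lambda>i. f (\<sigma> i)) [n+1..<2*n]) x) = 0"
proof (rule jacobi_sum_eq_0[OF assms(1) _ assms(2)])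
  show "\<not> inj_on (\<lambda>m. if m \<le> n then frame_key h \<iota>' (m - 1) else frame_key h \<iota> (m - n))
      ({1..2*n-1} - {k + 1})"
    if "\<iota> \<in> perm_pairs" "\<iota>' \<in> perm_pairs" "k < n" for \<iota> \<iota>' k
    using frame_key_collision[OF h n that(3)] that(1,2) by (cases \<iota>, cases \<iota>') auto
qed (use n in auto)

lemma frame_independent:
  assumes x: "x \<in> U"
  shows "inj_on (\<lambda>\<kappa>. frame \<kappa> x) (UNIV \<times> {1..n})"
    and "independent ((\<lambda>\<kappa>. frame \<kappa> x) ` (UNIV \<times> {1..n}))"
proof -
  have "a \<kappa> = 0" if "(\<Sum>\<kappa>\<in>UNIV \<times> {1..n}. a \<kappa> *\<^sub>R frame \<kappa> x) = 0" and \<kappa>: "\<kappa> \<in> UNIV \<times> {1..n}"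
    for a :: "bool \<times> nat \<Rightarrow> real" and \<kappa>
  proof -
    have "(\<Sum>i=1..n. a (True, i) *\<^sub>R V i x) + (\<Sum>i=1..n. a (False, i) *\<^sub>R W i x) = 0"
      using that(1) by (simp add: sum.cartesian_product' UNIV_bool frame_def add.commute)
    from independent_VW[OF x this, of "snd \<kappa>"] \<kappa> show ?thesis
      by (cases \<kappa>; cases "fst \<kappa>") auto
  qed
  then show "inj_on (\<lambda>\<kappa>. frame \<kappa> x) (UNIV \<times> {1..n})"
    and "independent ((\<lambda>\<kappa>. frame \<kappa> x) ` (UNIV \<times> {1..n}))"
    by (rule independent_family[rotated]; auto)+
qed

text \<open>Contract with the product of the functionals dual to the frame fields at all positions but the
  last of the term \<open>\<iota>\<^sub>0\<close>. By rigidity the terms that survive all end in the same field and have the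
  same sign, so the result is a nonzero multiple of this field.\<close>

lemma frame_in_span_contractions:
  assumes x: "x \<in> U" and \<iota>0: "\<iota>0 \<in> perm_pairs"
  shows "frame (frame_key h \<iota>0 (n - 1)) x \<in>
    span ((\<lambda>\<omega>. contraction A x n \<omega> (P x)) ` forms A (n - 1) x)"
proof -
  obtain \<sigma>0 p0 where \<iota>0_eq: "\<iota>0 = (\<sigma>0, p0)" and \<sigma>0: "\<sigma>0 permutes {1..n}" and p0: "p0 permutes {..<n}"
    using \<iota>0 by auto
  have n0: "n > 0"
    using n by simp
  define t where "t = frame (frame_key h \<iota>0 (n - 1)) x"
  let ?K = "UNIV \<times> {1..n}"
  have key: "frame_key h \<iota> k \<in> ?K" if "\<iota> \<in> perm_pairs" "k < n" for \<iota> k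
    using frame_key_index[of "fst \<iota>" n "snd \<iota>" k h] that by (auto simp: mem_Times_iff)
  have "\<exists>\<theta>. linear \<theta> \<and>
      (k < n \<longrightarrow> (\<forall>l\<in>?K. \<theta> (frame l x) = (if l = frame_key h \<iota>0 k then 1 else 0 :: real)))" for k
  proof (cases "k < n")
    case True
    then show ?thesis
      using dual_functional[OF frame_independent[OF x] key[OF \<iota>0 True]] by metis
  next
    case False
    then show ?thesis
      using module_hom_zero by blast
  qed
  then obtain \<theta> where lin: "\<And>k. linear (\<theta> k)" and
    dual: "\<And>k l. k < n \<Longrightarrow> l \<in> ?K \<Longrightarrow> \<theta> k (frame l x) = (if l = frame_key h \<iota>0 k then 1 else 0 :: real)"
    by metis
  \<comment> \<open>\<open>N \<iota> q\<close> is \<open>1\<close> if \<open>\<iota>\<close> is a rearrangement of \<open>\<iota>0\<close> by \<open>q\<close> away from the last position, and \<open>0\<close>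
    otherwise.\<close>
  define N where "N \<iota> q = (\<Prod>k<n-1. \<theta> (q k) (frame (frame_key h \<iota> k) x))" for \<iota> q
  have N: "N \<iota> q = (if \<forall>k<n-1. frame_key h \<iota> k = frame_key h \<iota>0 (q k) then 1 else 0)"
    if \<iota>: "\<iota> \<in> perm_pairs" and q: "q permutes {..<n-1}" for \<iota> q
  proof -
    have "\<theta> (q k) (frame (frame_key h \<iota> k) x) =
        (if frame_key h \<iota> k = frame_key h \<iota>0 (q k) then 1 else 0)" if "k < n - 1" for k
      using that permutes_in_image[OF q, of k] by (intro dual key \<iota>) auto
    then have "N \<iota> q = (\<Prod>k<n-1. if frame_key h \<iota> k = frame_key h \<iota>0 (q k) then 1 else 0)"
      unfolding N_def by (intro prod.cong) auto
    then show ?thesis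
      by (auto simp: prod_zero_iff intro!: prod.neutral)
  qed
  let ?Q = "{q. q permutes {..<n-1}}"
  have finite_Q: "finite ?Q"
    by (simp add: finite_permutations)
  define C where "C = coefficient \<iota>0 / fact (n - 1)"
  have summand: "(coefficient \<iota> * (\<Sum>q\<in>?Q. of_int (sign q) * N \<iota> q) / fact (n - 1)) *\<^sub>R
      frame (frame_key h \<iota> (n - 1)) x = (C * (\<Sum>q\<in>?Q. N \<iota> q)) *\<^sub>R t"
    if \<iota>: "\<iota> \<in> perm_pairs" for \<iota>
  proof -
    obtain \<sigma> p where \<iota>_eq: "\<iota> = (\<sigma>, p)" and \<sigma>: "\<sigma> permutes {1..n}" and p: "p permutes {..<n}"
      using \<iota> by auto
    have q_term: "(coefficient \<iota> * (of_int (sign q) * N \<iota> q)) *\<^sub>R frame (frame_key h \<iota> (n - 1)) x =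
        (coefficient \<iota>0 * N \<iota> q) *\<^sub>R t" if q: "q \<in> ?Q" for q
    proof (cases "\<forall>k<n-1. frame_key h \<iota> k = frame_key h \<iota>0 (q k)")
      case True
      have q': "q permutes {..<n-1}"
        using q by simp
      have eq: "frame_key h (\<sigma>, p) k = frame_key h (\<sigma>0, p0) (q k)" if "k < n - 1" for k
        using True that by (simp add: \<iota>_eq \<iota>0_eq)
      have rigid: "frame_key h (\<sigma>, p) (n - 1) = frame_key h (\<sigma>0, p0) (n - 1)"
        "sign \<sigma> * sign p * sign q = sign \<sigma>0 * sign p0"
        using frame_key_rigid[OF n0 \<sigma> p \<sigma>0 p0 q'] eq by blast+
      have last: "frame (frame_key h \<iota> (n - 1)) x = t"
        unfolding t_def \<iota>_eq \<iota>0_eq rigid(1) ..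
      have "real_of_int (sign \<sigma>) * of_int (sign p) * of_int (sign q) =
          of_int (sign \<sigma>0) * of_int (sign p0)"
        using rigid(2) by (metis of_int_mult)
      then have "coefficient \<iota> * of_int (sign q) = coefficient \<iota>0"
        unfolding coefficient_def \<iota>_eq \<iota>0_eq prod.case by (simp add: mult.assoc)
      then show ?thesis
        unfolding last by (simp add: mult.assoc[symmetric])
    next
      case False
      then have "N \<iota> q = 0"
        using N[OF \<iota>, of q] q by simp
      then show ?thesis by simp
    qed
    have "(coefficient \<iota> * (\<Sum>q\<in>?Q. of_int (sign q) * N \<iota> q) / fact (n - 1)) *\<^sub>R
        frame (frame_key h \<iota> (n - 1)) x =
      (1 / fact (n - 1)) *\<^sub>R (\<Sum>q\<in>?Q. (coefficient \<iota> * (of_int (sign q) * N \<iota> q)) *\<^sub>R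
        frame (frame_key h \<iota> (n - 1)) x)"
      by (simp add: scaleR_sum_left[symmetric] sum_distrib_left[symmetric])
    also have "\<dots> = (1 / fact (n - 1)) *\<^sub>R (\<Sum>q\<in>?Q. (coefficient \<iota>0 * N \<iota> q) *\<^sub>R t)"
      by (intro arg_cong2[where f="(*\<^sub>R)"] refl sum.cong q_term)
    also have "\<dots> = (C * (\<Sum>q\<in>?Q. N \<iota> q)) *\<^sub>R t"
      by (simp add: C_def scaleR_sum_left[symmetric] sum_distrib_left[symmetric])
    finally show ?thesis .
  qed
  define M where "M = (\<Sum>\<iota>\<in>perm_pairs. \<Sum>q\<in>?Q. N \<iota> q)"
  have contr: "contraction A x n (det_form (n - 1) \<theta>) (P x) = (C * M) *\<^sub>R t"
    unfolding contraction_det_form[OF x n0 lin] N_def[symmetric] M_def sum_distrib_left scaleR_sum_left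
    using summand by (simp add: sum_distrib_left scaleR_sum_left)
  \<comment> \<open>The term \<open>\<iota>0\<close> itself survives, with \<open>q\<close> the identity.\<close>
  have "0 < (\<Sum>q\<in>?Q. N \<iota>0 q)"
  proof (rule sum_pos2[OF finite_Q])
    show "id \<in> ?Q"
      by (simp add: permutes_id)
    show "0 < N \<iota>0 id"
      using N[OF \<iota>0 permutes_id] by (simp add: id_def)
    show "0 \<le> N \<iota>0 q" if "q \<in> ?Q" for q
      using N[OF \<iota>0] that by simp
  qed
  then have "0 < M"
    unfolding M_def
  proof (rule sum_pos2[OF finite_I \<iota>0])
    show "0 \<le> (\<Sum>q\<in>?Q. N \<iota> q)" if "\<iota> \<in> perm_pairs" for \<iota>
      using N[OF that] by (intro sum_nonneg) simp
  qed
  moreover have "C \<noteq> 0"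
    by (simp add: C_def coefficient_def \<iota>0_eq sign_def)
  ultimately have "t = (1 / (C * M)) *\<^sub>R contraction A x n (det_form (n - 1) \<theta>) (P x)"
    unfolding contr by simp
  moreover have "det_form (n - 1) \<theta> \<in> forms A (n - 1) x"
    unfolding forms_def using alternating_on_det_form[OF lin] by simp
  ultimately show ?thesis
    unfolding t_def[symmetric] by (metis (no_types, lifting) imageI span_base span_scale)
qed

lemma rank_at_eq:
  assumes x: "x \<in> U"
  shows "rank_at A n P x = (if h \<noteq> 0 then 2 * n else n)"
proof -
  let ?im = "(\<lambda>\<omega>. contraction A x n \<omega> (P x)) ` forms A (n - 1) x"
  define K where "K = (if h \<noteq> 0 then UNIV else {False}) \<times> {1..n}"
  let ?B = "(\<lambda>\<kappa>. frame \<kappa> x) ` K"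
  have n0: "n > 0"
    using n by simp
  have K_sub: "K \<subseteq> UNIV \<times> {1..n}"
    by (auto simp: K_def)
  have key: "frame_key h \<iota> (n - 1) \<in> K" if \<iota>: "\<iota> \<in> perm_pairs" for \<iota>
    using frame_key_index[of "fst \<iota>" n "snd \<iota>" "n - 1" h] \<iota> n0
    by (cases \<iota>) (auto simp: K_def frame_key_def)
  have "?im \<subseteq> span ?B"
  proof
    fix v assume "v \<in> ?im"
    then obtain \<omega> where v: "v = contraction A x n \<omega> (P x)"
      by blast
    show "v \<in> span ?B"
      unfolding v contraction_expansion[OF x n0]
      by (intro span_sum span_scale span_base imageI key)
  qed
  moreover have "?B \<subseteq> span ?im"
  proof
    fix v assume "v \<in> ?B"
    then obtain \<kappa> where \<kappa>: "\<kappa> \<in> K" "v = frame \<kappa> x"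
      by blast
    have "h < n"
      using h n by simp
    moreover have "snd \<kappa> \<in> {1..n}" "fst \<kappa> \<longrightarrow> h > 0"
      using \<kappa>(1) by (auto simp: K_def split: if_splits)
    ultimately obtain \<sigma> p where
      "\<sigma> permutes {1..n}" "p permutes {..<n}" "frame_key h (\<sigma>, p) (n - 1) = \<kappa>"
      by (rule frame_key_last_surj)
    then show "v \<in> span ?im"
      using frame_in_span_contractions[OF x, of "(\<sigma>, p)"] \<kappa>(2) by simp
  qed
  ultimately have "span ?B = span ?im"
    by (metis span_eq)
  moreover have "independent ?B"
    using frame_independent(2)[OF x] by (rule independent_mono) (use K_sub in auto)
  ultimately have "rank_at A n P x = card ?B"
    unfolding rank_at_def by (rule dim_eq_card)
  also have "\<dots> = card K"
    by (rule card_image[OF inj_on_subset[OF frame_independent(1)[OF x] K_sub]])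
  also have "\<dots> = (if h \<noteq> 0 then 2 * n else n)"
    by (simp add: K_def card_UNIV_bool)
  finally show ?thesis .
qed

end

theorem proposition2:
  fixes X :: "'a topology"
    and A :: "('a, 'e::euclidean_space) chart set"
    and n h :: nat
    and P :: "'a \<Rightarrow> ('a, 'e) mvec"
  assumes "smooth_manifold X A"
    and "n \<ge> 3"
    and "2 * h \<le> n - 3"
    and "multivector_field A n P"
    and "\<forall>x\<in>topspace X. \<exists>U. \<exists>V W :: nat \<Rightarrow> 'a \<Rightarrow> ('a, 'e) tvec.
           openin X U \<and> x \<in> U \<and>
           (\<forall>i\<in>{1..n}. smooth_vector_field_on A U (V i) \<and> smooth_vector_field_on A U (W i)) \<and>
           (\<forall>y\<in>U. \<forall>a b :: nat \<Rightarrow> real.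
              (\<Sum>i=1..n. a i *\<^sub>R V i y) + (\<Sum>i=1..n. b i *\<^sub>R W i y) = 0 \<longrightarrow>
              (\<forall>i\<in>{1..n}. a i = 0 \<and> b i = 0)) \<and>
           (\<forall>y\<in>U. \<forall>\<alpha>s\<in>arg_lists (cotangent_space A y) n.
              P y \<alpha>s =
                1 / (fact h * fact (n - h)) *
                (\<Sum>\<sigma> | \<sigma> permutes {1..n}.
                   of_int (sign \<sigma>) *
                   wedge (map (\<lambda>i. V (\<sigma> i) y) [1..<h+1] @ map (\<lambda>i. W (\<sigma> i) y) [h+1..<n+1]) \<alpha>s))"
  shows "poisson_multivector A n P \<and>
         (\<forall>x\<in>topspace X. rank_at A n P x = (if h \<noteq> 0 then 2 * n else n))"
proof -
  have local: "\<exists>U V W. x \<in> U \<and> two_frame_multivector X A U n h P V W" if "x \<in> topspace X" for x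
  proof -
    from bspec[OF assms(5) that] obtain U V W where *: "openin X U" "x \<in> U"
      "\<forall>i\<in>{1..n}. smooth_vector_field_on A U (V i) \<and> smooth_vector_field_on A U (W i)"
      "\<forall>y\<in>U. \<forall>a b :: nat \<Rightarrow> real.
        (\<Sum>i=1..n. a i *\<^sub>R V i y) + (\<Sum>i=1..n. b i *\<^sub>R W i y) = 0 \<longrightarrow>
        (\<forall>i\<in>{1..n}. a i = 0 \<and> b i = 0)"
      "\<forall>y\<in>U. \<forall>\<alpha>s\<in>arg_lists (cotangent_space A y) n.
        P y \<alpha>s =
          1 / (fact h * fact (n - h)) *
          (\<Sum>\<sigma> | \<sigma> permutes {1..n}.
             of_int (sign \<sigma>) *
             wedge (map (\<lambda>i. V (\<sigma> i) y) [1..<h+1] @ map (\<lambda>i. W (\<sigma> i) y) [h+1..<n+1]) \<alpha>s)"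
      by (elim exE conjE) (rule that)
    have "two_frame_multivector X A U n h P V W"
    proof unfold_locales
      show "a i = 0 \<and> b i = 0" if y: "y \<in> U" and i: "i \<in> {1..n}"
        and ab: "(\<Sum>i=1..n. a i *\<^sub>R V i y) + (\<Sum>i=1..n. b i *\<^sub>R W i y) = 0" for y i a b
        using *(4)[rule_format, OF y ab i] .
      show "P y \<alpha>s = 1 / (fact h * fact (n - h)) *
          (\<Sum>\<sigma> | \<sigma> permutes {1..n}. of_int (sign \<sigma>) *
            wedge (map (\<lambda>i. V (\<sigma> i) y) [1..<h+1] @ map (\<lambda>i. W (\<sigma> i) y) [h+1..<n+1]) \<alpha>s)"
        if y: "y \<in> U" and \<alpha>s: "\<alpha>s \<in> arg_lists (cotangent_space A y) n" for y \<alpha>s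
        using *(5)[rule_format, OF y \<alpha>s] .
    qed (use *(1,3) assms(1-3) in auto)
    with *(2) show ?thesis
      by blast
  qed
  have topspace: "topspace X = (\<Union>c\<in>A. fst c)"
    using assms(1) by (simp add: smooth_manifold_def)
  show ?thesis
    unfolding poisson_multivector_def
  proof (intro conjI allI impI ballI assms(4))
    fix f :: "nat \<Rightarrow> 'a \<Rightarrow> real" and x
    assume f: "\<forall>i\<in>{1..2*n-1}. smooth_function A (f i)" and "x \<in> (\<Union>c\<in>A. fst c)"
    then have "x \<in> topspace X"
      unfolding topspace by simp
    from local[OF this] obtain U V W where "x \<in> U" "two_frame_multivector X A U n h P V W"
      by blast
    from two_frame_multivector.jacobi_identity[OF this(2,1)] f
    show "(\<Sum>\<sigma> | \<sigma> permutes {1..2*n-1}. of_int (sign \<sigma>) *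
        bracket A P
          (bracket A P (map (\<lambda>i. f (\<sigma> i)) [1..<n+1]) # map (\<lambda>i. f (\<sigma> i)) [n+1..<2*n]) x) = 0"
      by blast
  next
    fix x assume "x \<in> topspace X"
    from local[OF this] obtain U V W where "x \<in> U" "two_frame_multivector X A U n h P V W"
      by blast
    then show "rank_at A n P x = (if h \<noteq> 0 then 2 * n else n)"
      by (intro two_frame_multivector.rank_at_eq)
  qed
qed

end
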